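(* Let $G$ be a finite unicyclic graph whose unique cycle $H=x_1x_2x_3x_4x_1$ has length $4$. Then $D_3(G)$ is connected if and only if $G$ has a $3$-induced subgraph isomorphic to $H_{3k+1}$ or $H_{3k+2}$ for some integer $k\geqslant 0$, or to one of the following graphs $G_1,G_2,G_3$, each consisting of a $4$-cycle $y_1y_2y_3y_4y_1$ with pendant trees attached: $G_1$: each of $y_1,y_2,y_3,y_4$ has one pendant vertex (8 vertices); $G_2$: $y_1$ and $y_2$ each have one pendant vertex, and $y_3$ has a pendant path of length $2$, i.e. $y_3-p-q$ with $p,q$ new vertices (8 vertices); $G_3$: $y_2$ and $y_3$ each have a pendant path of length $2$ (8 vertices).
   Context: A unicyclic graph is a connected graph containing exactly one cycle. The $3$-distance graph $D_3(G)$ has vertex set $V(G)$, two vertices being adjacent iff their distance in $G$ is exactly $3$. A subgraph $H$ of $G$ is $3$-induced if for all $x,y\in V(H)$ with $d_G(x,y)\leqslant 3$ one has $d_H(x,y)=d_G(x,y)$. For a positive integer $t$, $H_t$ is the tree with vertices $a_1,a_2,a_3,u_0,u_1,\dots,u_t,b_1,b_2,b_3$ and edges $a_1a_2$, $a_2u_0$, $u_iu_{i+1}$ ($0\leqslant i<t$), $u_tb_2$, $b_2b_1$, $a_3u_0$, $b_3u_t$. *)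

theory Defs
  imports "Graph_Theory.Graph_Theory"
begin

text \<open>
  Finite simple graphs are values of type \<^typ>\<open>'a pair_pre_digraph\<close> satisfying
  \<^locale>\<open>pair_graph\<close>: each undirected edge is represented by its two opposite arcs.
\<close>

definition edge_graph :: "('a \<times> 'a) set \<Rightarrow> 'a pair_pre_digraph" where
  "edge_graph E = \<lparr> pverts = Field E, parcs = E \<union> E\<inverse> \<rparr>"

text \<open>
  Graph distance is the library's shortest-path distance for unit arc weights;
  it is \<open>\<infinity>\<close> between different components.
\<close>

definition gdist :: "'a pair_pre_digraph \<Rightarrow> 'a \<Rightarrow> 'a \<Rightarrow> ereal" where
  "gdist G u v = wf_digraph.\<mu> (with_proj G) (\<lambda>_. 1) u v"

definition distance3_graph :: "'a pair_pre_digraph \<Rightarrow> 'a pair_pre_digraph" where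
  "distance3_graph G =
     \<lparr> pverts = pverts G,
       parcs = {(x, y). x \<in> pverts G \<and> y \<in> pverts G \<and> gdist G x y = 3} \<rparr>"

text \<open>
  The library predicate \<^const>\<open>pre_digraph.cycle\<close> is about directed closed walks, so in a
  symmetric digraph it also accepts an edge traversed back and forth, and it distinguishes
  starting points and orientations. An undirected cycle is therefore taken to be a subgraph:
  the vertex list \<open>[x\<^sub>1, \<dots>, x\<^sub>n]\<close> below yields the edges
  \<open>x\<^sub>1x\<^sub>2, \<dots>, x\<^sub>n\<^sub>-\<^sub>1x\<^sub>n, x\<^sub>nx\<^sub>1\<close>.
\<close>

definition cycle_graph :: "'a list \<Rightarrow> 'a pair_pre_digraph" where
  "cycle_graph xs = edge_graph (set (zip xs (rotate1 xs)))"

definition cycle_subgraph :: "'a pair_pre_digraph \<Rightarrow> 'a pair_pre_digraph \<Rightarrow> bool" where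
  "cycle_subgraph C G \<longleftrightarrow>
     (\<exists>xs. distinct xs \<and> length xs \<ge> 3 \<and> C = cycle_graph xs) \<and>
     subgraph (with_proj C) (with_proj G)"

definition unicyclic :: "'a pair_pre_digraph \<Rightarrow> bool" where
  "unicyclic G \<longleftrightarrow>
     pair_graph G \<and> connected (with_proj G) \<and> (\<exists>!C. cycle_subgraph C G)"

definition three_induced_subgraph :: "'a pair_pre_digraph \<Rightarrow> 'a pair_pre_digraph \<Rightarrow> bool" where
  "three_induced_subgraph H G \<longleftrightarrow>
     pair_graph H \<and> subgraph (with_proj H) (with_proj G) \<and>
     (\<forall>x \<in> pverts H. \<forall>y \<in> pverts H. gdist G x y \<le> 3 \<longrightarrow> gdist H x y = gdist G x y)"

definition has_three_induced :: "'a pair_pre_digraph \<Rightarrow> 'b pair_pre_digraph \<Rightarrow> bool" where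
  "has_three_induced G K \<longleftrightarrow>
     (\<exists>H. three_induced_subgraph H G \<and> digraph_iso (with_proj H) (with_proj K))"

datatype h_vertex = Va nat | Vb nat | Vu nat

definition H_tree :: "nat \<Rightarrow> h_vertex pair_pre_digraph" where
  "H_tree t = edge_graph
     ({(Va 1, Va 2), (Va 2, Vu 0), (Vu t, Vb 2), (Vb 2, Vb 1), (Va 3, Vu 0), (Vb 3, Vu t)}
      \<union> {(Vu i, Vu (Suc i)) | i. i < t})"

text \<open>In the next three graphs the vertices \<open>y\<^sub>1, \<dots>, y\<^sub>4\<close> are the numbers 1 to 4.\<close>

definition G1 :: "nat pair_pre_digraph" where
  "G1 = edge_graph {(1, 2), (2, 3), (3, 4), (4, 1), (1, 5), (2, 6), (3, 7), (4, 8)}"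

definition G2 :: "nat pair_pre_digraph" where
  "G2 = edge_graph {(1, 2), (2, 3), (3, 4), (4, 1), (1, 5), (2, 6), (3, 7), (7, 8)}"

definition G3 :: "nat pair_pre_digraph" where
  "G3 = edge_graph {(1, 2), (2, 3), (3, 4), (4, 1), (2, 5), (5, 6), (3, 7), (7, 8)}"

end

theory Submission
  imports Defs
begin

text \<open>
  Since \<open>G\<close> is bipartite, two vertices are at distance 3 iff they are nonadjacent ends of a path with
  three edges.

  If \<open>D\<^sub>3\<close> connects a 3-induced copy of one of the listed graphs, the copy can be enlarged vertex by
  vertex: a new vertex \<open>v\<close> adjacent to \<open>w\<close> is at distance 3 from the end \<open>b\<close> of any path \<open>w, a, b\<close> already
  present, unless these four vertices form the 4-cycle, and then another old vertex can replace \<open>b\<close>.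

  Conversely, if \<open>G\<^sub>1\<close> is absent, some cycle vertex, say \<open>x\<^sub>4\<close>, has degree 2 and \<open>G - x\<^sub>4\<close> is a tree.
  Root it at \<open>u\<close> and let \<open>A\<close> be the set of vertices whose level is divisible by 3. A path with three edges in
  the tree changes membership in \<open>A\<close> only if it turns at a vertex \<open>w\<close> of level \<open>m\<close> not divisible by 3 that has
  a child and a grandchild on different branches; if the root has a suitable tripod too, then \<open>u\<close> and
  \<open>w\<close> are the ends of the spine of a copy of \<open>H\<^sub>m\<close>. When \<open>x\<^sub>2\<close> has degree 2 as well, \<open>x\<^sub>2\<close> and \<open>x\<^sub>4\<close> are
  twins, and rooting first at \<open>x\<^sub>2\<close> yields a branching vertex, at which the tree is rooted again. Otherwise
  the absence of \<open>G\<^sub>2\<close> and \<open>G\<^sub>3\<close> allows the labelling to be chosen so that \<open>x\<^sub>1\<close> and \<open>x\<^sub>3\<close> carry only leaves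
  and \<open>x\<^sub>1\<close> carries at least one; then \<open>x\<^sub>2\<close> itself is a root with a tripod.
\<close>

section \<open>Distances and 3-induced copies\<close>

text \<open>Library walks are arc lists; relation powers replace them in every later distance
  argument.\<close>

lemma awalk_iff_relpow:
  assumes "pair_wf_digraph G" "u \<in> pverts G"
  shows "(\<exists>p. pre_digraph.awalk (with_proj G) u p v \<and> length p = n) \<longleftrightarrow> (u, v) \<in> parcs G ^^ n"
proof -
  interpret pair_wf_digraph G by fact
  show ?thesis
    using assms(2)
  proof (induction n arbitrary: u)
    case 0
    then show ?case by (auto simp: awalk_Nil_iff)
  next
    case (Suc n)
    show ?case
    proof
      assume "\<exists>p. awalk u p v \<and> length p = Suc n"
      then obtain e p where p: "awalk u (e # p) v" "length p = n"
        by (metis length_Suc_conv)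
      then have e: "e \<in> parcs G" "fst e = u" "awalk (snd e) p v"
        by (auto simp: awalk_Cons_iff)
      then have "(snd e, v) \<in> parcs G ^^ n"
        using Suc.IH[of "snd e"] p arc_snd_in_verts by blast
      then show "(u, v) \<in> parcs G ^^ Suc n"
        using e by (metis prod.collapse relpow_Suc_I2)
    next
      assume "(u, v) \<in> parcs G ^^ Suc n"
      then obtain w where w: "(u, w) \<in> parcs G" "(w, v) \<in> parcs G ^^ n"
        by (metis relpow_Suc_D2)
      then obtain p where "awalk w p v" "length p = n"
        using Suc.IH[of w] in_arcsD2 by blast
      then have "awalk u ((u, w) # p) v \<and> length ((u, w) # p) = Suc n"
        using w by (auto simp: awalk_Cons_iff)
      then show "\<exists>p. awalk u p v \<and> length p = Suc n" by blast
    qed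
  qed
qed

lemma gdist_eq_INF:
  assumes "pair_wf_digraph G" "u \<in> pverts G"
  shows "gdist G u v = (INF n \<in> {n. (u, v) \<in> parcs G ^^ n}. ereal (real n))"
proof -
  interpret pair_wf_digraph G by fact
  have cost: "awalk_cost (\<lambda>_. 1) p = real (length p)" for p
    by (induction p) (auto simp: awalk_cost_def)
  have "{n. (u, v) \<in> parcs G ^^ n} = length ` {p. awalk u p v}"
    using awalk_iff_relpow[OF assms, symmetric] by (auto simp: image_iff)
  then show ?thesis
    by (simp add: gdist_def \<mu>_def cost image_image)
qed

lemma gdist_le_iff:
  assumes "pair_wf_digraph G" "u \<in> pverts G"
  shows "gdist G u v \<le> ereal (real n) \<longleftrightarrow> (\<exists>m \<le> n. (u, v) \<in> parcs G ^^ m)"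
proof
  assume le: "gdist G u v \<le> ereal (real n)"
  show "\<exists>m \<le> n. (u, v) \<in> parcs G ^^ m"
  proof (rule ccontr)
    assume "\<not> ?thesis"
    then have "ereal (real (Suc n)) \<le> (INF n \<in> {n. (u, v) \<in> parcs G ^^ n}. ereal (real n))"
      by (intro INF_greatest) (auto simp del: of_nat_Suc simp: not_less_eq_eq)
    then have "ereal (real (Suc n)) \<le> ereal (real n)"
      using le gdist_eq_INF[OF assms, of v] by (metis order_trans)
    then show False by simp
  qed
next
  assume "\<exists>m \<le> n. (u, v) \<in> parcs G ^^ m"
  then show "gdist G u v \<le> ereal (real n)"
    unfolding gdist_eq_INF[OF assms] by (auto intro: INF_lower2)
qed

lemma gdist_mono:
  assumes "pair_wf_digraph G" "u \<in> pverts G" "pair_wf_digraph H" "u' \<in> pverts H"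
    and "\<And>n. (u, v) \<in> parcs G ^^ n \<Longrightarrow> \<exists>m \<le> n. (u', v') \<in> parcs H ^^ m"
  shows "gdist H u' v' \<le> gdist G u v"
  unfolding gdist_eq_INF[OF assms(1,2)] gdist_eq_INF[OF assms(3,4)]
proof (rule INF_mono)
  fix n assume "n \<in> {n. (u, v) \<in> parcs G ^^ n}"
  then obtain m where "m \<le> n" "(u', v') \<in> parcs H ^^ m" using assms(5) by auto
  then show "\<exists>m \<in> {n. (u', v') \<in> parcs H ^^ n}. ereal (real m) \<le> ereal (real n)"
    by (intro bexI[of _ m]) auto
qed

lemma gdist_eq_3_iff:
  assumes "pair_wf_digraph G" "u \<in> pverts G"
  shows "gdist G u v = 3 \<longleftrightarrow> (u, v) \<in> parcs G ^^ 3 \<and> (\<forall>m < 3. (u, v) \<notin> parcs G ^^ m)"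
proof -
  have "gdist G u v = 3 \<longleftrightarrow> gdist G u v \<le> ereal (real 3) \<and> \<not> gdist G u v \<le> ereal (real 2)"
  proof
    assume "gdist G u v = 3"
    then show "gdist G u v \<le> ereal (real 3) \<and> \<not> gdist G u v \<le> ereal (real 2)"
      by (simp add: numeral_eq_ereal)
  next
    assume *: "gdist G u v \<le> ereal (real 3) \<and> \<not> gdist G u v \<le> ereal (real 2)"
    then have m: "\<not> (\<exists>m \<le> 2. (u, v) \<in> parcs G ^^ m)"
      using gdist_le_iff[OF assms] by blast
    have "ereal (real 3) \<le> gdist G u v"
      unfolding gdist_eq_INF[OF assms]
    proof (rule INF_greatest)
      fix n assume "n \<in> {n. (u, v) \<in> parcs G ^^ n}"
      with m have "\<not> n \<le> 2" by blast
      then show "ereal (real 3) \<le> ereal (real n)" by simp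
    qed
    with * show "gdist G u v = 3" by (simp add: antisym numeral_eq_ereal)
  qed
  also have "\<dots> \<longleftrightarrow> (u, v) \<in> parcs G ^^ 3 \<and> (\<forall>m < 3. (u, v) \<notin> parcs G ^^ m)"
  proof -
    have "m \<le> 3 \<longleftrightarrow> m = 3 \<or> m \<le> 2" "m < 3 \<longleftrightarrow> m \<le> 2" for m :: nat by auto
    then show ?thesis unfolding gdist_le_iff[OF assms] by metis
  qed
  finally show ?thesis .
qed

lemma relpow_hom:
  assumes "\<And>a b. (a, b) \<in> R \<Longrightarrow> (f a, f b) \<in> S" "(a, b) \<in> R ^^ n"
  shows "(f a, f b) \<in> S ^^ n"
  using assms(2)
proof (induction n arbitrary: b)
  case 0
  then show ?case by simp
next
  case (Suc n)
  then obtain c where "(a, c) \<in> R ^^ n" "(c, b) \<in> R" by auto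
  then have "(f a, f c) \<in> S ^^ n" "(f c, f b) \<in> S" by (simp_all only: Suc.IH assms(1))
  then show ?case by (rule relpow_Suc_I)
qed

text \<open>A map that may contract arcs never lengthens a walk; this makes retractions
  non-expanding.\<close>

lemma relpow_weak_hom:
  assumes "\<And>a b. (a, b) \<in> R \<Longrightarrow> f a = f b \<or> (f a, f b) \<in> S" "(a, b) \<in> R ^^ n"
  shows "\<exists>m \<le> n. (f a, f b) \<in> S ^^ m"
  using assms(2)
proof (induction n arbitrary: b)
  case 0
  then show ?case by (auto intro: exI[of _ 0])
next
  case (Suc n)
  then obtain c where c: "(a, c) \<in> R ^^ n" "(c, b) \<in> R" by auto
  then obtain m where m: "m \<le> n" "(f a, f c) \<in> S ^^ m" using Suc.IH by blast
  from assms(1)[OF c(2)] show ?case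
  proof
    assume "f c = f b"
    with m show ?thesis by (intro exI[of _ m]) auto
  next
    assume "(f c, f b) \<in> S"
    with m show ?thesis by (intro exI[of _ "Suc m"]) auto
  qed
qed

text \<open>A non-expanding retraction onto the image of \<open>\<phi>\<close> makes that image isometric in \<open>G\<close>.\<close>

lemma has_three_inducedI:
  assumes G: "pair_graph G" and K: "pair_graph K"
    and \<phi>: "\<And>a. a \<in> pverts K \<Longrightarrow> \<phi> a \<in> pverts G"
      "\<And>a b. (a, b) \<in> parcs K \<Longrightarrow> (\<phi> a, \<phi> b) \<in> parcs G"
    and \<rho>: "\<And>a. a \<in> pverts K \<Longrightarrow> \<rho> (\<phi> a) = a"
      "\<And>x y. (x, y) \<in> parcs G \<Longrightarrow> \<rho> x = \<rho> y \<or> (\<rho> x, \<rho> y) \<in> parcs K"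
  shows "has_three_induced G K"
proof -
  interpret G: pair_graph G by fact
  interpret K: pair_graph K by fact
  define H where "H = \<lparr> pverts = \<phi> ` pverts K, parcs = map_prod \<phi> \<phi> ` parcs K \<rparr>"
  have Kv: "a \<in> pverts K" "b \<in> pverts K" if "(a, b) \<in> parcs K" for a b
    using that K.in_arcsD1 K.in_arcsD2 by auto
  have Harc: "(x, y) \<in> parcs H \<Longrightarrow> (\<rho> x, \<rho> y) \<in> parcs K" for x y
    using \<rho>(1) Kv by (auto simp: H_def)
  have sub: "parcs H \<subseteq> parcs G" "pverts H \<subseteq> pverts G"
    using \<phi> by (auto simp: H_def)
  have pgH: "pair_graph H"
  proof
    show "finite (pverts H)" "finite (parcs H)"
      by (auto simp: H_def K.pair_finite_verts K.pair_finite_arcs)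
    fix e assume e: "e \<in> parcs H"
    then show "fst e \<in> pverts H" "snd e \<in> pverts H" using Kv by (auto simp: H_def)
    show "fst e \<noteq> snd e" using e sub G.pair_no_loops by auto
  next
    show "symmetric (with_proj H)"
      using K.arcs_symmetric by (fastforce simp: symmetric_def sym_def H_def)
  qed
  then interpret H: pair_graph H .
  have hom: "subgraph (with_proj H) (with_proj G)"
    using sub by (auto simp: subgraph_def compatible_def intro: G.wf_digraph H.wf_digraph)
      (unfold_locales)
  have mono: "(x, y) \<in> parcs G ^^ n" if "(x, y) \<in> parcs H ^^ n" for x y n
    using relpow_hom[of "parcs H" "\<lambda>x. x" "parcs G" x y n] that sub by auto
  have "gdist H x y = gdist G x y" if x: "x \<in> pverts H" and y: "y \<in> pverts H" for x y
  proof (rule antisym)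
    obtain a b where ab: "a \<in> pverts K" "x = \<phi> a" "b \<in> pverts K" "y = \<phi> b"
      using x y by (auto simp: H_def)
    show "gdist H x y \<le> gdist G x y"
    proof (rule gdist_mono)
      fix n assume "(x, y) \<in> parcs G ^^ n"
      \<comment> \<open>A walk in \<open>G\<close> is pushed down to \<open>K\<close> by
        \<open>\<rho>\<close> and lifted back into \<open>H\<close> by \<open>\<phi>\<close>,
        without getting longer.\<close>
      from relpow_weak_hom[of _ \<rho> "parcs K", OF \<rho>(2) this] obtain m where m: "m \<le> n" "(a, b) \<in> parcs K ^^ m"
        using ab \<rho>(1) by auto
      have "(\<phi> a, \<phi> b) \<in> parcs H ^^ m"
        by (rule relpow_hom[OF _ m(2)]) (force simp: H_def)
      then show "\<exists>m\<le>n. (x, y) \<in> parcs H ^^ m" using m ab by auto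
    qed (use x sub in \<open>auto intro: H.pair_wf_digraph G.pair_wf_digraph\<close>)
    show "gdist G x y \<le> gdist H x y"
      by (rule gdist_mono)
        (use x sub mono in \<open>auto intro: H.pair_wf_digraph G.pair_wf_digraph\<close>)
  qed
  then have ind: "three_induced_subgraph H G"
    using pgH hom by (simp add: three_induced_subgraph_def)
  define f where "f = \<lparr> iso_verts = \<rho>, iso_arcs = map_prod \<rho> \<rho>, iso_head = snd, iso_tail = fst \<rparr>"
  have inj: "inj_on \<rho> (pverts H)" using \<rho>(1) by (auto simp: H_def inj_on_def)
  have "H.digraph_isomorphism f"
    unfolding H.digraph_isomorphism_def f_def
    using inj H.in_arcsD1 H.in_arcsD2 by (auto simp: inj_on_def intro: H.wf_digraph) unfold_locales
  moreover have "with_proj K = app_iso f (with_proj H)"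
  proof -
    have "\<rho> ` pverts H = pverts K" using \<rho>(1) by (force simp: H_def)
    moreover have "map_prod \<rho> \<rho> ` parcs H = parcs K"
    proof -
      have "map_prod \<rho> \<rho> (map_prod \<phi> \<phi> e) = e" if "e \<in> parcs K" for e
        using \<rho>(1) Kv that by (cases e) auto
      then show ?thesis by (simp add: H_def image_image)
    qed
    ultimately show ?thesis by (simp add: app_iso_def f_def with_proj_def)
  qed
  ultimately show ?thesis
    using ind by (auto simp: has_three_induced_def digraph_iso_def)
qed

text \<open>Adjacent vertices of \<open>G\<close> fall under the 3-induced condition, so the
  embedding reflects adjacency. This later carries nonadjacency from \<open>K\<close> over to
  \<open>G\<close>.\<close>

lemma has_three_inducedE:
  assumes G: "pair_graph G" and "has_three_induced G K"
  obtains \<phi> where "inj_on \<phi> (pverts K)"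
    "\<And>a. a \<in> pverts K \<Longrightarrow> \<phi> a \<in> pverts G"
    "\<And>a b. (a, b) \<in> parcs K \<Longrightarrow> (\<phi> a, \<phi> b) \<in> parcs G"
    "\<And>a b. a \<in> pverts K \<Longrightarrow> b \<in> pverts K \<Longrightarrow> (\<phi> a, \<phi> b) \<in> parcs G \<Longrightarrow> (a, b) \<in> parcs K"
proof -
  interpret G: pair_graph G by fact
  obtain H f where H: "pair_graph H" "subgraph (with_proj H) (with_proj G)"
    and ind: "\<And>x y. x \<in> pverts H \<Longrightarrow> y \<in> pverts H \<Longrightarrow> gdist G x y \<le> 3 \<Longrightarrow> gdist H x y = gdist G x y"
    and f: "pre_digraph.digraph_isomorphism (with_proj H) f" "with_proj K = app_iso f (with_proj H)"
    using assms(2) by (auto simp: has_three_induced_def three_induced_subgraph_def digraph_iso_def)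
  interpret H: pair_graph H by fact
  define \<rho> where "\<rho> = iso_verts f"
  have sub: "pverts H \<subseteq> pverts G" "parcs H \<subseteq> parcs G"
    using H(2) by (auto simp: subgraph_def)
  have inj: "inj_on \<rho> (pverts H)" using f(1) by (simp add: H.digraph_isomorphism_def \<rho>_def)
  \<comment> \<open>\<open>with_proj\<close> has \<open>fst\<close> and \<open>snd\<close> as tail
    and head maps, so equality of the records fixes these fields of \<open>f\<close>.\<close>
  have ends: "iso_tail f = fst" "iso_head f = snd"
    using arg_cong[OF f(2), of tail] arg_cong[OF f(2), of head] by simp_all
  have V: "pverts K = \<rho> ` pverts H" using arg_cong[OF f(2), of verts] by (simp add: \<rho>_def)
  have "iso_arcs f e = map_prod \<rho> \<rho> e" if "e \<in> parcs H" for e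
    using f(1) that unfolding H.digraph_isomorphism_def ends \<rho>_def
    by (cases e, cases "iso_arcs f e") force
  then have A: "parcs K = map_prod \<rho> \<rho> ` parcs H"
    using arg_cong[OF f(2), of arcs] by simp
  define \<phi> where "\<phi> = the_inv_into (pverts H) \<rho>"
  have \<phi>: "\<phi> (\<rho> x) = x" if "x \<in> pverts H" for x
    using inj that by (simp add: \<phi>_def the_inv_into_f_f)
  show ?thesis
  proof
    show "inj_on \<phi> (pverts K)" using \<phi> by (auto simp: V inj_on_def)
    show "\<phi> a \<in> pverts G" if "a \<in> pverts K" for a using that \<phi> sub by (auto simp: V)
    show "(\<phi> a, \<phi> b) \<in> parcs G" if "(a, b) \<in> parcs K" for a b
      using that sub \<phi> H.in_arcsD1 H.in_arcsD2 by (fastforce simp: A)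
    fix a b assume ab: "a \<in> pverts K" "b \<in> pverts K" "(\<phi> a, \<phi> b) \<in> parcs G"
    then obtain x y where xy: "x \<in> pverts H" "a = \<rho> x" "y \<in> pverts H" "b = \<rho> y" by (auto simp: V)
    with ab \<phi> have "(x, y) \<in> parcs G" by simp
    then have le: "gdist G x y \<le> ereal (real 1)"
      unfolding gdist_le_iff[OF G.pair_wf_digraph subsetD[OF sub(1) xy(1)]]
      by (intro exI[of _ 1]) simp
    then have "gdist G x y \<le> 3" by (rule order_trans) (simp add: numeral_eq_ereal)
    with le ind xy have "gdist H x y \<le> ereal (real 1)" by simp
    then obtain m where "m \<le> 1" "(x, y) \<in> parcs H ^^ m"
      using gdist_le_iff[OF H.pair_wf_digraph, of x y 1] xy by blast
    moreover have "x \<noteq> y" using \<open>(x, y) \<in> parcs G\<close> G.no_loops' by auto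
    ultimately have "(x, y) \<in> parcs H" by (cases m) auto
    then show "(a, b) \<in> parcs K" using xy by (auto simp: A)
  qed
qed

section \<open>Rooted trees and graphs with a unique 4-cycle\<close>

lemma strongly_connected_pair_iff:
  assumes "parcs D \<subseteq> pverts D \<times> pverts D"
  shows "strongly_connected (with_proj D) \<longleftrightarrow>
    pverts D \<noteq> {} \<and> (\<forall>u \<in> pverts D. \<forall>v \<in> pverts D. (u, v) \<in> (parcs D)\<^sup>*)"
proof -
  have "(u, v) \<in> rtrancl_on (pverts D) (parcs D) \<longleftrightarrow> (u, v) \<in> (parcs D)\<^sup>*" if "u \<in> pverts D" for u v
  proof
    assume "(u, v) \<in> (parcs D)\<^sup>*"
    then show "(u, v) \<in> rtrancl_on (pverts D) (parcs D)"
    proof (induction rule: rtrancl_induct)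
      case (step y z)
      then show ?case using assms rtrancl_on_into_rtrancl_on[of u y "pverts D" "parcs D" z] by blast
    qed (use that in simp)
  qed (rule rtrancl_on_rtranclI)
  then show ?thesis by (auto simp: strongly_connected_def reachable_def)
qed

text \<open>Library connectivity symmetrises before testing strong connectivity; symmetric arcs are
  unchanged by this.\<close>

lemma connected_pair_iff:
  assumes "parcs D \<subseteq> pverts D \<times> pverts D" "sym (parcs D)"
  shows "connected (with_proj D) \<longleftrightarrow>
    pverts D \<noteq> {} \<and> (\<forall>u \<in> pverts D. \<forall>v \<in> pverts D. (u, v) \<in> (parcs D)\<^sup>*)"
proof -
  have "mk_symmetric (with_proj D) = D"
    using assms(2) by (intro pair_pre_digraph.equality) (auto simp: mk_symmetric_def dest: symD)
  then show ?thesis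
    using strongly_connected_pair_iff[OF assms(1)] by (simp add: connected_def)
qed

lemma parcs_cycle_graph_4:
  "parcs (cycle_graph [a, b, c, d]) = {(a, b), (b, c), (c, d), (d, a), (b, a), (c, b), (d, c), (a, d)}"
  by (auto simp: cycle_graph_def edge_graph_def)

lemma parcs_cycle_graph: "parcs (cycle_graph xs) = set (zip xs (rotate1 xs)) \<union> (set (zip xs (rotate1 xs)))\<inverse>"
  by (simp add: cycle_graph_def edge_graph_def)

lemma cycle_subgraphI:
  assumes "pair_graph G" "distinct xs" "length xs \<ge> 3" "set (zip xs (rotate1 xs)) \<subseteq> parcs G"
  shows "cycle_subgraph (cycle_graph xs) G"
proof -
  interpret pair_graph G by fact
  let ?C = "cycle_graph xs"
  have arcs: "parcs ?C \<subseteq> parcs G"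
    using assms(4) arcs_symmetric by (auto simp: parcs_cycle_graph)
  have verts: "pverts ?C = Field (parcs ?C)"
    by (auto simp: cycle_graph_def edge_graph_def Field_def)
  have "pverts ?C \<subseteq> pverts G"
    using arcs in_arcsD1 in_arcsD2 by (auto simp: verts Field_def)
  moreover have "pair_wf_digraph ?C"
    by unfold_locales (auto simp: verts Field_def)
  ultimately have "subgraph (with_proj ?C) (with_proj G)"
    using arcs by (simp add: subgraph_def compatible_def wf_digraph_wp_iff pair_wf_digraph)
  then show ?thesis
    using assms(2,3) by (auto simp: cycle_subgraph_def)
qed

text \<open>Acyclicity is encoded in \<open>arc\<close>: every arc joins a vertex to its parent.
  With \<open>g u = u\<close>, iterated parents stop at the root, in step with truncated subtraction
  on levels.\<close>

locale rooted_tree =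
  fixes W :: "'a set" and Q :: "('a \<times> 'a) set" and u :: 'a
    and g :: "'a \<Rightarrow> 'a" and l :: "'a \<Rightarrow> nat"
  assumes root: "u \<in> W" "g u = u" "l u = 0"
    and parent: "\<And>v. v \<in> W \<Longrightarrow> v \<noteq> u \<Longrightarrow> g v \<in> W \<and> (v, g v) \<in> Q \<and> l v = Suc (l (g v))"
    and arc: "\<And>a b. (a, b) \<in> Q \<Longrightarrow> a \<in> W \<and> b \<in> W \<and> (a \<noteq> u \<and> b = g a \<or> b \<noteq> u \<and> a = g b)"
    and Q_sym: "sym Q"
begin

lemma level_0: "v \<in> W \<Longrightarrow> l v = 0 \<Longrightarrow> v = u"
  using parent[of v] by (cases "v = u") auto

lemma level_arc: "(a, b) \<in> Q \<Longrightarrow> a \<noteq> u \<and> b = g a \<and> l a = Suc (l b) \<or> b \<noteq> u \<and> a = g b \<and> l b = Suc (l a)"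
  using arc parent by blast

lemma funpow_g_in: "v \<in> W \<Longrightarrow> (g ^^ n) v \<in> W"
proof (induction n)
  case (Suc n)
  then show ?case using parent[of "(g ^^ n) v"] root by (cases "(g ^^ n) v = u") auto
qed simp

lemma funpow_g_level: "v \<in> W \<Longrightarrow> l ((g ^^ n) v) = l v - n"
proof (induction n)
  case (Suc n)
  have "l (g w) = l w - 1" if "w \<in> W" for w
    using parent[OF that] root by (cases "w = u") auto
  with Suc funpow_g_in show ?case by simp
qed simp

lemma funpow_g_root: "v \<in> W \<Longrightarrow> (g ^^ l v) v = u"
  using funpow_g_level funpow_g_in level_0 by simp

text \<open>Keeping \<open>u\<close> out of \<open>s\<close>, \<open>t\<close>, \<open>t'\<close>
  rules out the false child that \<open>g u = u\<close> would provide.\<close>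

definition branching :: "'a \<Rightarrow> 'a \<Rightarrow> 'a \<Rightarrow> 'a \<Rightarrow> bool" where
  "branching w s t t' \<longleftrightarrow> {w, s, t, t'} \<subseteq> W \<and> u \<notin> {s, t, t'} \<and> g s = w \<and> g t = w \<and> s \<noteq> t \<and> g t' = t"

text \<open>A path of length 3 that neither climbs nor descends monotonically turns exactly once, at an inner
  vertex; the turning point branches, and the levels of the endpoints exceed its level by 1 and 2.\<close>

lemma level_mod_3_path:
  assumes path: "(p, a) \<in> Q" "(a, b) \<in> Q" "(b, q) \<in> Q" "p \<noteq> b" "a \<noteq> q"
    and no_branching: "\<And>w s t t'. branching w s t t' \<Longrightarrow> l w mod 3 = 0"
  shows "l p mod 3 = 0 \<longleftrightarrow> l q mod 3 = 0"
proof -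
  have W: "p \<in> W" "a \<in> W" "b \<in> W" "q \<in> W" using path arc by blast+
  \<comment> \<open>Going to a child and then to its parent would return to the same vertex, against
    \<open>p \<noteq> b\<close> or \<open>a \<noteq> q\<close>. Four of the eight up-down patterns
    remain.\<close>
  consider "l p = Suc (l a)" "l a = Suc (l b)" "l b = Suc (l q)"
    | "l a = Suc (l p)" "l b = Suc (l a)" "l q = Suc (l b)"
    | "p \<noteq> u" "a = g p" "l p = Suc (l a)" "b \<noteq> u" "a = g b" "l b = Suc (l a)" "q \<noteq> u" "b = g q" "l q = Suc (l b)"
    | "q \<noteq> u" "b = g q" "l q = Suc (l b)" "a \<noteq> u" "b = g a" "l a = Suc (l b)" "p \<noteq> u" "a = g p" "l p = Suc (l a)"
    using level_arc[OF path(1)] level_arc[OF path(2)] level_arc[OF path(3)] path(4,5) by metis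
  then show ?thesis
  proof cases
    case 1
    then have "l p = l q + 3" by simp
    then show ?thesis by simp
  next
    case 2
    then have "l q = l p + 3" by simp
    then show ?thesis by simp
  next
    case 3
    then have "branching a p b q" using W path(4) by (auto simp: branching_def)
    then have "l a mod 3 = 0" by (rule no_branching)
    then show ?thesis using 3(3,6,9) by presburger
  next
    case 4
    then have "branching b q a p" using W path(5) by (auto simp: branching_def)
    then have "l b mod 3 = 0" by (rule no_branching)
    then show ?thesis using 4(3,6,9) by presburger
  qed
qed

end

text \<open>Comparing arc sets makes \<open>unique\<close> insensitive to starting point and
  orientation, so the locale can be re-instantiated with relabelled cycles.\<close>

locale four_cycle_graph = pair_graph G for G :: "'a pair_pre_digraph" +
  fixes x1 x2 x3 x4 :: 'a
  assumes conn: "\<And>u v. u \<in> pverts G \<Longrightarrow> v \<in> pverts G \<Longrightarrow> (u, v) \<in> (parcs G)\<^sup>*"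
    and dist: "distinct [x1, x2, x3, x4]"
    and cyc: "(x1, x2) \<in> parcs G" "(x2, x3) \<in> parcs G" "(x3, x4) \<in> parcs G" "(x4, x1) \<in> parcs G"
    and unique: "\<And>xs. distinct xs \<Longrightarrow> length xs \<ge> 3 \<Longrightarrow> set (zip xs (rotate1 xs)) \<subseteq> parcs G \<Longrightarrow>
      parcs (cycle_graph xs) = parcs (cycle_graph [x1, x2, x3, x4])"
begin

abbreviation "V \<equiv> pverts G"
abbreviation "R \<equiv> parcs G"

lemmas R_sym = arcs_symmetric

lemma cyc': "(x2, x1) \<in> R" "(x3, x2) \<in> R" "(x4, x3) \<in> R" "(x1, x4) \<in> R"
  using cyc R_sym by auto

text \<open>This rotation and the reflection below generate all symmetries of the 4-cycle; arguments
  by symmetry become interpretations of this locale.\<close>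

lemma four_cycle_rotate: "four_cycle_graph G x2 x3 x4 x1"
proof unfold_locales
  fix xs assume "distinct xs" "3 \<le> length xs" "set (zip xs (rotate1 xs)) \<subseteq> R"
  from unique[OF this] show "parcs (cycle_graph xs) = parcs (cycle_graph [x2, x3, x4, x1])"
    by (auto simp: parcs_cycle_graph_4)
qed (use conn dist cyc in auto)

lemma four_cycle_reflect: "four_cycle_graph G x3 x2 x1 x4"
proof unfold_locales
  fix xs assume "distinct xs" "3 \<le> length xs" "set (zip xs (rotate1 xs)) \<subseteq> R"
  from unique[OF this] show "parcs (cycle_graph xs) = parcs (cycle_graph [x3, x2, x1, x4])"
    by (auto simp: parcs_cycle_graph_4)
qed (use conn dist cyc' in auto)

lemma four_cycle_unique:
  assumes "(a, b) \<in> R" "(b, c) \<in> R" "(c, d) \<in> R" "(d, a) \<in> R" "a \<noteq> c" "b \<noteq> d"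
  shows "{a, b, c, d} = {x1, x2, x3, x4}"
proof -
  have "distinct [a, b, c, d]" using assms no_loops' by auto
  then have "parcs (cycle_graph [a, b, c, d]) = parcs (cycle_graph [x1, x2, x3, x4])"
    using unique[of "[a, b, c, d]"] assms by simp
  then have "Field (parcs (cycle_graph [a, b, c, d])) = Field (parcs (cycle_graph [x1, x2, x3, x4]))"
    by simp
  moreover have "Field (parcs (cycle_graph [a, b, c, d])) = {a, b, c, d}" for a b c d :: 'a
    by (auto simp: parcs_cycle_graph_4 Field_def)
  ultimately show ?thesis by simp
qed

text \<open>A shortest path between the ends of an arc, closed up by that arc, is a cycle.\<close>

lemma arc_notin_rtrancl:
  assumes Q: "Q \<subseteq> R" "(x4, x1) \<notin> Q" "sym Q" and F: "F \<subseteq> Q" and uv: "(u, v) \<in> Q" "(u, v) \<notin> F"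
  shows "(u, v) \<notin> F\<^sup>*"
proof
  assume "(u, v) \<in> F\<^sup>*"
  \<comment> \<open>A walk of minimal length has distinct vertices: a repetition could be cut
    out.\<close>
  then obtain n where n: "(u, v) \<in> F ^^ n" "\<And>m. m < n \<Longrightarrow> (u, v) \<notin> F ^^ m"
    using rtrancl_imp_relpow exists_least_iff[of "\<lambda>n. (u, v) \<in> F ^^ n"] by metis
  then obtain p where p: "p 0 = u" "p n = v" "\<And>i. i < n \<Longrightarrow> (p i, p (Suc i)) \<in> F"
    by (auto simp: relpow_fun_conv)
  have seg: "(p i, p (i + k)) \<in> F ^^ k" if "i + k \<le> n" for i k
    unfolding relpow_fun_conv using that p(3) by (intro exI[of _ "\<lambda>j. p (i + j)"]) auto
  have neq: "p i \<noteq> p j" if "i < j" "j \<le> n" for i j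
  proof
    assume eq: "p i = p j"
    have "(u, p i) \<in> F ^^ i" using seg[of 0 i] that p(1) by simp
    moreover have "(p i, v) \<in> F ^^ (n - j)" using seg[of j "n - j"] that p(2) eq by simp
    ultimately have "(u, v) \<in> F ^^ (i + (n - j))" by (auto simp: relpow_add)
    with n(2)[of "i + (n - j)"] that show False by simp
  qed
  \<comment> \<open>Length 1 is excluded by \<open>(u, v) \<notin> F\<close>, so the closed-up path
    has at least three vertices.\<close>
  have "u \<noteq> v" using uv Q no_loops' by auto
  have "n \<noteq> 0" using \<open>u \<noteq> v\<close> p(1,2) by metis
  moreover have "n \<noteq> 1" using n(1) uv(2) by auto
  ultimately have n2: "n \<ge> 2" by simp
  let ?xs = "map p [0..<Suc n]"
  have dxs: "distinct ?xs" and lxs: "length ?xs = Suc n"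
    unfolding distinct_map inj_on_def
    by (metis atLeastLessThan_iff atLeastLessThan_upt distinct_upt less_Suc_eq_le linorder_neqE_nat neq) simp
  have rot: "rotate1 ?xs = map p ([1..<Suc n] @ [0])"
    by (simp add: upt_conv_Cons del: upt_Suc)
  have "e \<in> Q" if "e \<in> set (zip ?xs (rotate1 ?xs))" for e
  proof -
    from that obtain i where "i < length (zip ?xs (rotate1 ?xs))" "zip ?xs (rotate1 ?xs) ! i = e"
      unfolding in_set_conv_nth by (elim exE conjE)
    then have i: "i < Suc n" "e = (?xs ! i, rotate1 ?xs ! i)"
      by (simp_all only: length_zip nth_zip length_rotate1 lxs min.idem)
    have p_i: "?xs ! i = p i" using i(1) by (simp del: upt_Suc)
    show ?thesis
    proof (cases "i < n")
      case True
      then have "rotate1 ?xs ! i = p (Suc i)"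
        unfolding rot by (simp add: nth_append del: upt_Suc)
      then show ?thesis using True p(3) F i(2) p_i by auto
    next
      case False
      then have "i = n" using i(1) by simp
      then have "rotate1 ?xs ! i = p 0"
        unfolding rot by (simp add: nth_append del: upt_Suc)
      then show ?thesis using \<open>i = n\<close> p(1,2) uv(1) Q(3) i(2) p_i by (metis symD)
    qed
  qed
  then have sub: "set (zip ?xs (rotate1 ?xs)) \<subseteq> Q" by blast
  \<comment> \<open>By uniqueness this cycle inside \<open>Q\<close> is the 4-cycle, but
    \<open>Q\<close> lacks its arc \<open>(x4, x1)\<close>.\<close>
  then have "parcs (cycle_graph ?xs) = parcs (cycle_graph [x1, x2, x3, x4])"
    using Q(1) n2 by (intro unique dxs) (auto simp only: lxs)
  moreover have "parcs (cycle_graph ?xs) \<subseteq> Q"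
    using sub Q(3) by (auto simp: parcs_cycle_graph dest: symD)
  ultimately show False using Q(2) by (auto simp: parcs_cycle_graph_4)
qed

end

text \<open>Apply \<open>\<theta>\<close>, then iterate \<open>f\<close> until the copy is first
  met. This is a non-expanding retraction: off the copy a vertex and its \<open>f\<close>-image end
  at the same place, and on the copy \<open>f\<close> stays put or moves along an arc.\<close>

lemma has_three_induced_closed:
  fixes f \<theta> :: "'a \<Rightarrow> 'a"
  assumes G: "pair_graph G" and K: "pair_graph K"
    and f: "\<And>x y. (x, y) \<in> parcs G \<Longrightarrow> f (\<theta> x) = \<theta> y \<or> f (\<theta> y) = \<theta> x"
    and ev: "\<And>v. v \<in> pverts G \<Longrightarrow> \<exists>n. (f ^^ n) (\<theta> v) \<in> \<phi> ` pverts K"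
    and \<phi>: "inj_on \<phi> (pverts K)"
      "\<And>a. a \<in> pverts K \<Longrightarrow> \<phi> a \<in> pverts G \<and> \<theta> (\<phi> a) = \<phi> a"
      "\<And>a b. (a, b) \<in> parcs K \<Longrightarrow> (\<phi> a, \<phi> b) \<in> parcs G"
      "\<And>a. a \<in> pverts K \<Longrightarrow> f (\<phi> a) = \<phi> a \<or> (\<exists>b. (a, b) \<in> parcs K \<and> f (\<phi> a) = \<phi> b)"
  shows "has_three_induced G K"
proof -
  interpret G: pair_graph G by fact
  interpret K: pair_graph K by fact
  let ?S = "\<phi> ` pverts K"
  \<comment> \<open>\<open>N v\<close> counts the \<open>f\<close>-steps to the first visit of the
    copy, and \<open>r v\<close> is the vertex met there.\<close>
  define N where "N v = (LEAST n. (f ^^ n) v \<in> ?S)" for v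
  define r where "r v = (f ^^ N v) v" for v
  have r_in: "r v = v" if "v \<in> ?S" for v
    using that Least_eq_0[of "\<lambda>n. (f ^^ n) v \<in> ?S"] by (simp add: r_def N_def)
  have r_out: "r v = r (f v)" if "v \<notin> ?S" "(f ^^ n) v \<in> ?S" for v n
  proof -
    have "N v = Suc (N (f v))"
      unfolding N_def
      using Least_Suc[of "\<lambda>n. (f ^^ n) v \<in> ?S" n, OF that(2)] that(1) by (simp add: funpow_swap1)
    then show ?thesis by (simp add: r_def funpow_swap1)
  qed
  define \<rho> where "\<rho> v = the_inv_into (pverts K) \<phi> (r (\<theta> v))" for v
  have inv: "the_inv_into (pverts K) \<phi> (\<phi> a) = a" if "a \<in> pverts K" for a
    using \<phi>(1) that by (rule the_inv_into_f_f)
  have step: "\<rho> x = \<rho> y \<or> (\<rho> x, \<rho> y) \<in> parcs K" if x: "x \<in> pverts G" and xy: "f (\<theta> x) = \<theta> y" for x y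
  proof (cases "\<theta> x \<in> ?S")
    case True
    then obtain a where a: "a \<in> pverts K" "\<theta> x = \<phi> a" by auto
    from \<phi>(4)[OF a(1)] show ?thesis
    proof
      assume "f (\<phi> a) = \<phi> a"
      then show ?thesis using xy a by (simp add: \<rho>_def)
    next
      assume "\<exists>b. (a, b) \<in> parcs K \<and> f (\<phi> a) = \<phi> b"
      then obtain b where b: "(a, b) \<in> parcs K" "\<theta> y = \<phi> b" using xy a by auto
      then have "b \<in> pverts K" using K.in_arcsD2 by blast
      then have "\<rho> x = a" "\<rho> y = b" using a b r_in by (simp_all add: \<rho>_def inv)
      then show ?thesis using b by simp
    qed
  next
    case False
    with ev[OF x] r_out xy have "r (\<theta> x) = r (\<theta> y)" by metis
    then show ?thesis by (simp add: \<rho>_def)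
  qed
  show ?thesis
  proof (rule has_three_inducedI[OF G K, where \<phi> = \<phi> and \<rho> = \<rho>])
    show "\<rho> (\<phi> a) = a" if "a \<in> pverts K" for a
      using that \<phi>(2) r_in by (simp add: \<rho>_def inv)
    show "\<rho> x = \<rho> y \<or> (\<rho> x, \<rho> y) \<in> parcs K" if "(x, y) \<in> parcs G" for x y
      using f[OF that] step[of x y] step[of y x] G.in_arcsD1[OF that] G.in_arcsD2[OF that]
        K.arcs_symmetric by metis
  qed (use \<phi> in auto)
qed

text \<open>In a bipartite graph this is exactly distance 3; see
  \<open>arcs_distance3_graph\<close>.\<close>

definition dist3 :: "('a \<times> 'a) set \<Rightarrow> ('a \<times> 'a) set" where
  "dist3 R = {(x, y). (x, y) \<notin> R \<and> (\<exists>a b. (x, a) \<in> R \<and> (a, b) \<in> R \<and> (b, y) \<in> R)}"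

lemma dist3I: "(x, a) \<in> R \<Longrightarrow> (a, b) \<in> R \<Longrightarrow> (b, y) \<in> R \<Longrightarrow> (x, y) \<notin> R \<Longrightarrow> (x, y) \<in> dist3 R"
  by (auto simp: dist3_def)

lemma sym_dist3: "sym R \<Longrightarrow> sym (dist3 R)"
  unfolding dist3_def sym_def by blast

section \<open>Spanning trees, bipartiteness and the arcs of the 3-distance graph\<close>

context four_cycle_graph
begin

text \<open>Breadth-first search from \<open>u\<close>: levels are distances in \<open>Q\<close>,
  and a parent is a neighbour one level lower. An arc outside the search tree would close a cycle,
  which \<open>arc_notin_rtrancl\<close> forbids.\<close>

lemma rooted_tree_exists:
  assumes Q: "Q \<subseteq> R" "(x4, x1) \<notin> Q" "sym Q" "Q \<subseteq> W \<times> W"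
    and u: "u \<in> W" and reach: "\<And>v. v \<in> W \<Longrightarrow> (u, v) \<in> Q\<^sup>*"
  shows "\<exists>g l. rooted_tree W Q u g l"
proof -
  define l where "l v = (LEAST n. (u, v) \<in> Q ^^ n)" for v
  have l: "(u, v) \<in> Q ^^ l v" if "v \<in> W" for v
    unfolding l_def using reach[OF that] rtrancl_imp_relpow by (metis LeastI)
  have l_le: "l v \<le> n" if "(u, v) \<in> Q ^^ n" for v n
    unfolding l_def using that by (rule Least_le)
  have l_u: "l u = 0" using l_le[of u 0] by simp
  have ex: "\<exists>w. w \<in> W \<and> (v, w) \<in> Q \<and> l v = Suc (l w)" if v: "v \<in> W" "v \<noteq> u" for v
  proof -
    have "l v \<noteq> 0" using l[OF v(1)] v(2) by (metis Id_O_R R_O_Id pair_in_Id_conv relpow.simps(1))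
    then obtain n where n: "l v = Suc n" by (cases "l v") auto
    then obtain w where w: "(u, w) \<in> Q ^^ n" "(w, v) \<in> Q" using l[OF v(1)] by auto
    then have "w \<in> W" using Q by auto
    have "(u, v) \<in> Q ^^ Suc (l w)" using l[OF \<open>w \<in> W\<close>] w(2) by auto
    then have "l v \<le> Suc (l w)" by (rule l_le)
    then have "l w = n" using l_le[OF w(1)] n by simp
    then show ?thesis using w n \<open>w \<in> W\<close> Q(3) by (auto dest: symD)
  qed
  define g where "g v = (if v = u then u else SOME w. w \<in> W \<and> (v, w) \<in> Q \<and> l v = Suc (l w))" for v
  have g: "g v \<in> W \<and> (v, g v) \<in> Q \<and> l v = Suc (l (g v))" if "v \<in> W" "v \<noteq> u" for v
    using someI_ex[OF ex[OF that]] that by (simp add: g_def)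
  \<comment> \<open>\<open>F\<close> consists of the tree arcs in both directions; any two vertices
    of \<open>W\<close> are joined in it through the root.\<close>
  define F where "F = {(v, g v) | v. v \<in> W \<and> v \<noteq> u} \<union> {(g v, v) | v. v \<in> W \<and> v \<noteq> u}"
  have F: "F \<subseteq> Q" "sym F" using g Q(3) by (auto simp: F_def sym_def)
  have up: "(v, u) \<in> F\<^sup>*" if "v \<in> W" for v
    using that
  proof (induction "l v" arbitrary: v rule: less_induct)
    case less
    show ?case
    proof (cases "v = u")
      case False
      with g less have "(g v, u) \<in> F\<^sup>*" by simp
      moreover have "(v, g v) \<in> F" using less False by (auto simp: F_def)
      ultimately show ?thesis by (rule converse_rtrancl_into_rtrancl[rotated])
    qed simp
  qed
  have "rooted_tree W Q u g l"
  proof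
    fix a b assume ab: "(a, b) \<in> Q"
    then have W: "a \<in> W" "b \<in> W" using Q by auto
    have "(u, b) \<in> F\<^sup>*" using up[OF W(2)] F(2) by (metis sym_rtrancl symD)
    then have "(a, b) \<in> F\<^sup>*" using up[OF W(1)] by (rule rtrancl_trans[rotated])
    then have "(a, b) \<in> F" using arc_notin_rtrancl[OF Q(1-3) F(1) ab] by blast
    then show "a \<in> W \<and> b \<in> W \<and> (a \<noteq> u \<and> b = g a \<or> b \<noteq> u \<and> a = g b)"
      using W by (auto simp: F_def)
  qed (use u g l_u Q(3) in \<open>auto simp: g_def\<close>)
  then show ?thesis by blast
qed

text \<open>The rest of the 4-cycle is a detour for the deleted edge, so reachability is
  preserved.\<close>

lemma spanning_tree_exists:
  "\<exists>g l. rooted_tree V (R - {(x4, x1), (x1, x4)}) x4 g l"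
proof (rule rooted_tree_exists)
  let ?Q = "R - {(x4, x1), (x1, x4)}"
  have s: "sym ?Q" using R_sym by (auto simp: sym_def)
  have "(x4, x3) \<in> ?Q" "(x3, x2) \<in> ?Q" "(x2, x1) \<in> ?Q" using cyc' dist by auto
  then have "(x4, x1) \<in> ?Q\<^sup>*" by (meson converse_rtrancl_into_rtrancl rtrancl.rtrancl_refl)
  moreover from this have "(x1, x4) \<in> ?Q\<^sup>*" using s by (metis sym_rtrancl symD)
  ultimately have "R \<subseteq> ?Q\<^sup>*" by auto
  then have "R\<^sup>* \<subseteq> ?Q\<^sup>*" by (metis rtrancl_mono rtrancl_idemp)
  then show "(x4, v) \<in> ?Q\<^sup>*" if "v \<in> V" for v using conn that in_arcsD1[OF cyc(4)] by blast
  show "sym ?Q" by fact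
  show "x4 \<in> V" using in_arcsD1[OF cyc(4)] .
qed (use in_arcsD1 in_arcsD2 in auto)

text \<open>Colour by parity of the tree level. The deleted edge is also properly coloured, since
  its ends are joined by the three tree arcs of the cycle.\<close>

lemma bipartite: "\<exists>c :: 'a \<Rightarrow> bool. \<forall>a b. (a, b) \<in> R \<longrightarrow> c a \<noteq> c b"
proof -
  obtain g l where "rooted_tree V (R - {(x4, x1), (x1, x4)}) x4 g l"
    using spanning_tree_exists by blast
  then interpret T: rooted_tree V "R - {(x4, x1), (x1, x4)}" x4 g l .
  have eo: "even (l a) \<noteq> even (l b)" if "(a, b) \<in> R - {(x4, x1), (x1, x4)}" for a b
    using T.level_arc[OF that] by auto
  have "even (l x1) \<noteq> even (l x2)" "even (l x2) \<noteq> even (l x3)" "even (l x3) \<noteq> even (l x4)"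
    using eo[of x1 x2] eo[of x2 x3] eo[of x3 x4] cyc dist by auto
  then have "even (l a) \<noteq> even (l b)" if "(a, b) \<in> R" for a b
    using eo[of a b] that by (cases "(a, b) \<in> {(x4, x1), (x1, x4)}") auto
  then show ?thesis by (intro exI[of _ "\<lambda>a. even (l a)"]) blast
qed

text \<open>The spanning tree at \<open>x4\<close> is modified by giving the root the parent
  \<open>x1\<close>. The map then runs round the cycle and accounts for every arc, the deleted one
  included.\<close>

lemma parent_map:
  obtains f where "f x1 = x2" "f x2 = x3" "f x3 = x4" "f x4 = x1"
    "\<And>a b. (a, b) \<in> R \<Longrightarrow> f a = b \<or> f b = a" "\<And>v. v \<in> V \<Longrightarrow> \<exists>n. (f ^^ n) v = x4"
proof -
  let ?Q = "R - {(x4, x1), (x1, x4)}"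
  obtain g l where "rooted_tree V ?Q x4 g l"
    using spanning_tree_exists by blast
  then interpret T: rooted_tree V ?Q x4 g l .
  \<comment> \<open>Found outward from the root: once \<open>g x3 = x4\<close> is known, the arc
    between \<open>x2\<close> and \<open>x3\<close> can only mean \<open>g x2 = x3\<close>, and so
    on.\<close>
  have g: "g x3 = x4" "g x2 = x3" "g x1 = x2"
    using T.arc[of x3 x4] T.arc[of x2 x3] T.arc[of x1 x2] cyc dist by auto
  define f where "f = g(x4 := x1)"
  have 1: "f x1 = x2" "f x2 = x3" "f x3 = x4" "f x4 = x1"
    using dist g by (auto simp: f_def)
  have 2: "f a = b \<or> f b = a" if "(a, b) \<in> R" for a b
    using T.arc[of a b] that 1 by (cases "(a, b) \<in> {(x4, x1), (x1, x4)}") (auto simp: f_def)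
  have 3: "\<exists>n. (f ^^ n) v = x4" if "v \<in> V" for v
    using that
  proof (induction "l v" arbitrary: v rule: less_induct)
    case less
    show ?case
    proof (cases "v = x4")
      case False
      with T.parent less obtain n where "(f ^^ n) (g v) = x4" by (metis lessI)
      then have "(f ^^ Suc n) v = x4" using False by (simp add: f_def funpow_swap1)
      then show ?thesis by blast
    qed (auto intro: exI[of _ 0])
  qed
  show ?thesis by (rule that[OF 1 2 3])
qed

text \<open>The ends of a walk with three arcs have different colours, which excludes distances 0
  and 2; only adjacency must be ruled out separately.\<close>

lemma arcs_distance3_graph: "parcs (distance3_graph G) = dist3 R"
proof -
  obtain c :: "'a \<Rightarrow> bool" where c: "\<And>a b. (a, b) \<in> R \<Longrightarrow> c a \<noteq> c b" using bipartite by blast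
  have "(x, y) \<in> R ^^ 3 \<and> (\<forall>m < 3. (x, y) \<notin> R ^^ m) \<longleftrightarrow> (x, y) \<in> dist3 R" for x y
  proof -
    have eq: "(\<forall>m < 3. (x, y) \<notin> R ^^ m) \<longleftrightarrow> x \<noteq> y \<and> (x, y) \<notin> R \<and> (\<nexists>z. (x, z) \<in> R \<and> (z, y) \<in> R)"
      by (auto simp: numeral_3_eq_3 less_Suc_eq)
    have 3: "(x, y) \<in> R ^^ 3 \<longleftrightarrow> (\<exists>a b. (x, a) \<in> R \<and> (a, b) \<in> R \<and> (b, y) \<in> R)"
      by (auto simp: numeral_3_eq_3)
    show ?thesis unfolding eq 3 dist3_def using c by simp metis
  qed
  moreover have "x \<in> V \<and> y \<in> V" if "(x, y) \<in> dist3 R" for x y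
    using that in_arcsD1 in_arcsD2 by (auto simp: dist3_def)
  ultimately show ?thesis
    using gdist_eq_3_iff[OF pair_wf_digraph] by (auto simp: distance3_graph_def)
qed

lemma R_sym': "sym R"
  using R_sym by (auto simp: sym_def)

lemma connected_distance3_graph_iff:
  "connected (with_proj (distance3_graph G)) \<longleftrightarrow> (\<forall>u \<in> V. \<forall>v \<in> V. (u, v) \<in> (dist3 R)\<^sup>*)"
proof -
  have [simp]: "pverts (distance3_graph G) = V" by (simp add: distance3_graph_def)
  have "V \<noteq> {}" using in_arcsD1 cyc by auto
  moreover have "dist3 R \<subseteq> V \<times> V" using in_arcsD1 in_arcsD2 by (auto simp: dist3_def)
  ultimately show ?thesis
    using sym_dist3[OF R_sym'] by (subst connected_pair_iff) (simp_all add: arcs_distance3_graph)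
qed

end

section \<open>Growing a copy\<close>

lemma pair_graph_edge_graph:
  assumes "finite E" "\<And>a. (a, a) \<notin> E"
  shows "pair_graph (edge_graph E)"
proof unfold_locales
  show "finite (pverts (edge_graph E))"
    using finite_Field[OF assms(1)] by (simp add: edge_graph_def)
  show "symmetric (with_proj (edge_graph E))"
    by (auto simp: edge_graph_def symmetric_def sym_def)
  show "fst e \<noteq> snd e" if "e \<in> parcs (edge_graph E)" for e
    using assms(2) that by (cases e) (auto simp: edge_graph_def)
qed (use assms(1) in \<open>auto simp: edge_graph_def Field_def\<close>)

lemma rtrancl_map:
  assumes "\<And>a b. (a, b) \<in> A \<Longrightarrow> (f a, f b) \<in> B" "(a, b) \<in> A\<^sup>*"
  shows "(f a, f b) \<in> B\<^sup>*"
  using assms(2)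
proof (induction rule: rtrancl_induct)
  case (step y z)
  then show ?case using assms(1)[of y z] by (simp add: rtrancl_into_rtrancl)
qed simp

text \<open>The configuration at each end of the spine of \<open>H_t\<close>: a centre
  \<open>p\<close> with a longer leg through \<open>p'\<close>.\<close>

definition tripod :: "('a \<times> 'a) set \<Rightarrow> 'a set \<Rightarrow> 'a \<Rightarrow> 'a \<Rightarrow> bool" where
  "tripod R S p p' \<longleftrightarrow> p \<in> S \<and> p' \<in> S \<and> (p, p') \<in> R \<and> (\<exists>a \<in> S. a \<noteq> p \<and> (p', a) \<in> R) \<and>
    (\<exists>b \<in> S. \<exists>c \<in> S. b \<noteq> p' \<and> c \<noteq> p' \<and> b \<noteq> c \<and> (p, b) \<in> R \<and> (p, c) \<in> R)"

lemma tripodI: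
  assumes "{p, p', a, b, c} \<subseteq> S" "{(p, p'), (p', a), (p, b), (p, c)} \<subseteq> R"
    "a \<noteq> p" "b \<noteq> p'" "c \<noteq> p'" "b \<noteq> c"
  shows "tripod R S p p'"
  unfolding tripod_def using assms by blast

lemma tripod_mono: "tripod R S p p' \<Longrightarrow> S \<subseteq> T \<Longrightarrow> tripod R T p p'"
  unfolding tripod_def by (meson subsetD)

context four_cycle_graph
begin

text \<open>If \<open>v\<close> is adjacent to \<open>w\<close> and \<open>w, a, b\<close> is a path in \<open>S\<close>, then \<open>v\<close> and \<open>b\<close> are at distance 3
  unless \<open>v, w, a, b\<close> is the 4-cycle. In the latter case some other vertex of \<open>S\<close> serves in place of \<open>b\<close>,
  unless \<open>S\<close> is a double star with centres \<open>w\<close> and \<open>b\<close> joined through \<open>a\<close>.\<close>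

lemma dist3_extend:
  assumes S: "S \<subseteq> V" "v \<notin> S" and w: "w \<in> S" "(w, v) \<in> R"
    and ab: "a \<in> S" "b \<in> S" "(w, a) \<in> R" "(a, b) \<in> R" "b \<noteq> w"
    and con: "\<And>x. x \<in> S \<Longrightarrow> (w, x) \<in> (R \<inter> S \<times> S)\<^sup>*"
    and big: "{x1, x2, x3, x4} \<subseteq> S \<or>
      (\<exists>p p' q q'. tripod R S p p' \<and> tripod R S q q' \<and> p \<noteq> q \<and> p' \<noteq> q')"
  shows "\<exists>c \<in> S. (c, v) \<in> dist3 R"
proof (rule ccontr)
  assume no: "\<not> ?thesis"
  \<comment> \<open>Under the assumption, \<open>v\<close> is adjacent to every vertex of
    \<open>S\<close> that ends a path of two arcs from \<open>w\<close>; below, the same from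
    \<open>b\<close>.\<close>
  have dist3: "(v, c) \<in> R" if "c \<in> S" "(w, d) \<in> R" "(d, c) \<in> R" for c d
    using no that w dist3I[of c d R w v] R_sym by blast
  have dist3': "(v, c) \<in> R" if "c \<in> S" "(b, d) \<in> R" "(d, c) \<in> R" "(v, b) \<in> R" for c d
    using no that dist3I[of c d R b v] R_sym by blast
  have vb: "(v, b) \<in> R" by (rule dist3[OF ab(2-4)])
  have "v \<noteq> a" using S ab by auto
  then have C: "{v, w, a, b} = {x1, x2, x3, x4}"
    using four_cycle_unique[of v w a b] vb w ab R_sym by auto
  \<comment> \<open>Another neighbour \<open>c\<close> of \<open>a\<close> in \<open>S\<close> would
    give the 4-cycle \<open>v, w, a, c\<close>, placing \<open>c\<close> among
    \<open>v, w, a, b\<close>.\<close>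
  have a_nbr: "c = w \<or> c = b" if "c \<in> S" "(a, c) \<in> R" for c
  proof (rule ccontr)
    assume neq: "\<not> ?thesis"
    then have "{v, w, a, c} = {x1, x2, x3, x4}" "c \<noteq> b"
      using four_cycle_unique[of v w a c] dist3[OF that(1) ab(3) that(2)] that w ab(3) R_sym \<open>v \<noteq> a\<close>
      by auto
    then have "c \<in> {v, w, a, b}" using C by auto
    then show False using neq that S no_loops' by auto
  qed
  obtain col :: "'a \<Rightarrow> bool" where col: "\<And>a b. (a, b) \<in> R \<Longrightarrow> col a \<noteq> col b" using bipartite by blast
  \<comment> \<open>A further edge at \<open>c\<close> would give the 4-cycle
    \<open>v, w, c, e\<close>; then \<open>c\<close> could only be \<open>b\<close>, which has the
    colour of \<open>w\<close>.\<close>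
  have w_leaf: "e = w" if "c \<in> S" "(w, c) \<in> R" "c \<noteq> a" "e \<in> S" "(c, e) \<in> R" for c e
  proof (rule ccontr)
    assume "e \<noteq> w"
    have "v \<noteq> c" using that S by auto
    then have "{v, w, c, e} = {x1, x2, x3, x4}"
      using four_cycle_unique[of v w c e] dist3[OF that(4,2,5)] that w R_sym \<open>e \<noteq> w\<close> by auto
    then have "c \<in> {v, w, a, b}" using C by auto
    then have "c = b" using that \<open>v \<noteq> c\<close> no_loops' by auto
    then show False using col[OF that(2)] col[OF ab(3)] col[OF ab(4)] by auto
  qed
  have b_leaf: "e = b" if "c \<in> S" "(b, c) \<in> R" "c \<noteq> a" "e \<in> S" "(c, e) \<in> R" for c e
  proof (rule ccontr)
    assume "e \<noteq> b"
    have "v \<noteq> c" using that S by auto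
    then have "{v, b, c, e} = {x1, x2, x3, x4}"
      using four_cycle_unique[of v b c e] dist3'[OF that(4,2,5) vb] that vb R_sym \<open>e \<noteq> b\<close> by auto
    then have "c \<in> {v, w, a, b}" using C by auto
    then have "c = w" using that \<open>v \<noteq> c\<close> no_loops' by auto
    then show False using col[OF that(2)] col[OF ab(3)] col[OF ab(4)] by auto
  qed
  have star: "x \<in> {w, a, b} \<or> (w, x) \<in> R \<or> (b, x) \<in> R" if "x \<in> S" for x
    using con[OF that]
  proof (induction rule: rtrancl_induct)
    case (step y z)
    then have yz: "y \<in> S" "z \<in> S" "(y, z) \<in> R" by auto
    from step.IH show ?case
      using a_nbr[of z] w_leaf[of y z] b_leaf[of y z] yz by blast
  qed simp
  have not_C: "\<not> {x1, x2, x3, x4} \<subseteq> S" using C S(2) by auto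
  \<comment> \<open>A tripod centre has three neighbours in \<open>S\<close>, whereas
    \<open>a\<close> has at most two and the leaves have only one.\<close>
  have centre: "p \<in> {w, b}" if tri: "tripod R S p p'" for p p'
  proof (rule ccontr)
    assume p: "p \<notin> {w, b}"
    obtain c d where cd: "p \<in> S" "p' \<in> S" "c \<in> S" "d \<in> S" "c \<noteq> p'" "d \<noteq> p'" "c \<noteq> d"
        "(p, p') \<in> R" "(p, c) \<in> R" "(p, d) \<in> R"
      using tri unfolding tripod_def by blast
    then have "p \<noteq> a" using a_nbr[of p'] a_nbr[of c] a_nbr[of d] by blast
    then have "(w, p) \<in> R \<or> (b, p) \<in> R" using star[of p] p cd(1) by auto
    then show False
      using w_leaf[of p p'] w_leaf[of p c] b_leaf[of p p'] b_leaf[of p c] cd \<open>p \<noteq> a\<close> by metis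
  qed
  \<comment> \<open>\<open>p'\<close> has a second neighbour, so it is not a leaf. All tripods thus
    share the middle vertex \<open>a\<close>, against \<open>p' \<noteq> q'\<close>.\<close>
  have mid: "p' = a" if tri: "tripod R S p p'" for p p'
  proof -
    obtain d where "p' \<in> S" "d \<in> S" "d \<noteq> p" "(p, p') \<in> R" "(p', d) \<in> R"
      using tri unfolding tripod_def by blast
    with centre[OF tri] w_leaf[of p' d] b_leaf[of p' d] show ?thesis by blast
  qed
  from big not_C mid show False by blast
qed

text \<open>A maximal set satisfying the invariant \<open>I\<close> is closed under adjacency,
  because \<open>dist3_extend\<close> would let it absorb a missing neighbour; by connectedness it
  is all of \<open>V\<close>.\<close>

lemma dist3_grow:
  assumes P: "P \<subseteq> V" "p0 \<in> P"
    and reach: "\<And>x. x \<in> P \<Longrightarrow> (p0, x) \<in> (dist3 R)\<^sup>*"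
    and con: "\<And>x. x \<in> P \<Longrightarrow> (p0, x) \<in> (R \<inter> P \<times> P)\<^sup>*"
    and two: "\<And>x. x \<in> P \<Longrightarrow> \<exists>a \<in> P. \<exists>b \<in> P. (x, a) \<in> R \<and> (a, b) \<in> R \<and> b \<noteq> x"
    and big: "{x1, x2, x3, x4} \<subseteq> P \<or>
      (\<exists>p p' q q'. tripod R P p p' \<and> tripod R P q q' \<and> p \<noteq> q \<and> p' \<noteq> q')"
    and v: "v \<in> V"
  shows "(p0, v) \<in> (dist3 R)\<^sup>*"
proof -
  define I where "I S \<longleftrightarrow> P \<subseteq> S \<and> S \<subseteq> V \<and> (\<forall>x \<in> S. (p0, x) \<in> (dist3 R)\<^sup>* \<and> (p0, x) \<in> (R \<inter> S \<times> S)\<^sup>* \<and>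
    (\<exists>a \<in> S. \<exists>b \<in> S. (x, a) \<in> R \<and> (a, b) \<in> R \<and> b \<noteq> x))" for S
  have "I P" using assms by (simp add: I_def)
  moreover have "finite {S. I S}"
    by (rule finite_subset[of _ "Pow V"]) (auto simp: I_def pair_finite_verts)
  ultimately obtain S where S: "I S" and max: "\<And>T. I T \<Longrightarrow> S \<subseteq> T \<Longrightarrow> S = T"
    using finite_has_maximal[of "{S. I S}"] by auto
  have S_R: "\<And>x. x \<in> S \<Longrightarrow> (p0, x) \<in> (R \<inter> S \<times> S)\<^sup>*" and SV: "S \<subseteq> V" and PS: "P \<subseteq> S"
    and S_two: "\<And>x. x \<in> S \<Longrightarrow> \<exists>a \<in> S. \<exists>b \<in> S. (x, a) \<in> R \<and> (a, b) \<in> R \<and> b \<noteq> x"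
    and S_reach: "\<And>x. x \<in> S \<Longrightarrow> (p0, x) \<in> (dist3 R)\<^sup>*"
    using S by (auto simp: I_def)
  have closed: "z \<in> S" if w: "w \<in> S" "(w, z) \<in> R" for w z
  proof (rule ccontr)
    assume z: "z \<notin> S"
    obtain a b where ab: "a \<in> S" "b \<in> S" "(w, a) \<in> R" "(a, b) \<in> R" "b \<noteq> w"
      using S_two[OF w(1)] by auto
    have sym: "sym (R \<inter> S \<times> S)" using R_sym by (auto simp: sym_def)
    have con': "(w, x) \<in> (R \<inter> S \<times> S)\<^sup>*" if "x \<in> S" for x
      using S_R[OF w(1)] S_R[OF that] sym by (meson rtrancl_trans sym_rtrancl symD)
    have big': "{x1, x2, x3, x4} \<subseteq> S \<or>
      (\<exists>p p' q q'. tripod R S p p' \<and> tripod R S q q' \<and> p \<noteq> q \<and> p' \<noteq> q')"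
      using big
    proof
      assume "{x1, x2, x3, x4} \<subseteq> P"
      then show ?thesis using PS by blast
    next
      assume "\<exists>p p' q q'. tripod R P p p' \<and> tripod R P q q' \<and> p \<noteq> q \<and> p' \<noteq> q'"
      then obtain p p' q q' where "tripod R P p p'" "tripod R P q q'" "p \<noteq> q" "p' \<noteq> q'" by blast
      then have "tripod R S p p'" "tripod R S q q'" using tripod_mono[OF _ PS] by metis+
      then show ?thesis using \<open>p \<noteq> q\<close> \<open>p' \<noteq> q'\<close> by metis
    qed
    obtain c where c: "c \<in> S" "(c, z) \<in> dist3 R"
      using dist3_extend[OF SV z w ab con' big'] by blast
    let ?T = "insert z S"
    have z_reach: "(p0, z) \<in> (dist3 R)\<^sup>*" using S_reach[OF c(1)] c(2) by (rule rtrancl_into_rtrancl)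
    have mono: "(R \<inter> S \<times> S)\<^sup>* \<subseteq> (R \<inter> ?T \<times> ?T)\<^sup>*" by (rule rtrancl_mono) auto
    have "(p0, z) \<in> (R \<inter> ?T \<times> ?T)\<^sup>*"
      using subsetD[OF mono S_R[OF w(1)]] w by (auto intro: rtrancl_into_rtrancl)
    \<comment> \<open>The new vertex starts the path \<open>z, w, a\<close>, which keeps
      \<open>dist3_extend\<close> applicable.\<close>
    moreover have "\<exists>a \<in> ?T. \<exists>b \<in> ?T. (z, a) \<in> R \<and> (a, b) \<in> R \<and> b \<noteq> z"
      using w ab R_sym z by blast
    moreover have "(p0, x) \<in> (R \<inter> ?T \<times> ?T)\<^sup>*" if "x \<in> S" for x
      using subsetD[OF mono S_R[OF that]] .
    moreover have "\<exists>a \<in> ?T. \<exists>b \<in> ?T. (x, a) \<in> R \<and> (a, b) \<in> R \<and> b \<noteq> x" if "x \<in> S" for x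
      using S_two[OF that] by blast
    ultimately have "I ?T"
      unfolding I_def using PS SV S_reach z_reach in_arcsD2[OF w(2)] by simp blast
    then show False using max z by blast
  qed
  have "p0 \<in> S" using P PS by auto
  have "(p0, v) \<in> R\<^sup>*" using conn P v by auto
  then have "v \<in> S"
    by (induction rule: rtrancl_induct) (use \<open>p0 \<in> S\<close> closed in auto)
  then show ?thesis by (rule S_reach)
qed

lemma connected_if_spanned:
  assumes "\<And>v. v \<in> V \<Longrightarrow> (p, v) \<in> (dist3 R)\<^sup>*"
  shows "connected (with_proj (distance3_graph G))"
  unfolding connected_distance3_graph_iff
proof (intro ballI)
  fix u v assume "u \<in> V" "v \<in> V"
  then have "(p, u) \<in> (dist3 R)\<^sup>*" "(p, v) \<in> (dist3 R)\<^sup>*" using assms by auto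
  then show "(u, v) \<in> (dist3 R)\<^sup>*"
    using sym_dist3[OF R_sym'] by (meson rtrancl_trans sym_rtrancl symD)
qed

lemma copy_reach:
  assumes \<phi>: "\<And>a b. (a, b) \<in> parcs K \<Longrightarrow> (\<phi> a, \<phi> b) \<in> R"
    "\<And>a b. a \<in> pverts K \<Longrightarrow> b \<in> pverts K \<Longrightarrow> (\<phi> a, \<phi> b) \<in> R \<Longrightarrow> (a, b) \<in> parcs K"
    and K: "pair_graph K" and "(a, b) \<in> (dist3 (parcs K))\<^sup>*"
  shows "(\<phi> a, \<phi> b) \<in> (dist3 R)\<^sup>*"
proof -
  interpret K: pair_graph K by fact
  have "(\<phi> x, \<phi> y) \<in> dist3 R" if "(x, y) \<in> dist3 (parcs K)" for x y
  proof -
    from that obtain p q where pq: "(x, p) \<in> parcs K" "(p, q) \<in> parcs K" "(q, y) \<in> parcs K"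
      and no: "(x, y) \<notin> parcs K"
      by (auto simp: dist3_def)
    then have "(\<phi> x, \<phi> y) \<notin> R" using \<phi>(2) K.in_arcsD1 K.in_arcsD2 by blast
    then show ?thesis using \<phi>(1) pq dist3I by metis
  qed
  then show ?thesis using assms(4) by (rule rtrancl_map)
qed

text \<open>The image of \<open>K\<close> is the seed for \<open>dist3_grow\<close>. The distinct
  vertices \<open>r\<close> and \<open>s\<close> ensure that no vertex of \<open>K\<close> is
  isolated in its 3-distance relation.\<close>

lemma connected_if_copy:
  assumes K: "pair_graph K" "has_three_induced G K"
    and big: "(\<exists>a b c d. {(a, b), (b, c), (c, d), (d, a)} \<subseteq> parcs K \<and> a \<noteq> c \<and> b \<noteq> d) \<or>
      (\<exists>p p' q q'. tripod (parcs K) (pverts K) p p' \<and> tripod (parcs K) (pverts K) q q' \<and> p \<noteq> q \<and> p' \<noteq> q')"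
    and r: "r \<in> pverts K" "s \<in> pverts K" "r \<noteq> s"
    and reach: "\<And>x. x \<in> pverts K \<Longrightarrow> (r, x) \<in> (parcs K)\<^sup>*"
      "\<And>x. x \<in> pverts K \<Longrightarrow> (r, x) \<in> (dist3 (parcs K))\<^sup>*"
  shows "connected (with_proj (distance3_graph G))"
proof -
  interpret K: pair_graph K by fact
  obtain \<phi> where \<phi>: "inj_on \<phi> (pverts K)" "\<And>a. a \<in> pverts K \<Longrightarrow> \<phi> a \<in> V"
    "\<And>a b. (a, b) \<in> parcs K \<Longrightarrow> (\<phi> a, \<phi> b) \<in> R"
    "\<And>a b. a \<in> pverts K \<Longrightarrow> b \<in> pverts K \<Longrightarrow> (\<phi> a, \<phi> b) \<in> R \<Longrightarrow> (a, b) \<in> parcs K"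
    using has_three_inducedE[OF pair_graph K(2)] by metis
  note Kv = K.in_arcsD1 K.in_arcsD2
  let ?P = "\<phi> ` pverts K"
  have inj: "\<phi> x \<noteq> \<phi> y" if "x \<in> pverts K" "y \<in> pverts K" "x \<noteq> y" for x y
    using \<phi>(1) that by (auto simp: inj_on_def)
  have tripod: "tripod R ?P (\<phi> p) (\<phi> p')" if tri: "tripod (parcs K) (pverts K) p p'" for p p'
  proof -
    obtain a b c where "p \<in> pverts K" "p' \<in> pverts K" "a \<in> pverts K" "b \<in> pverts K" "c \<in> pverts K"
      "(p, p') \<in> parcs K" "(p', a) \<in> parcs K" "a \<noteq> p" "b \<noteq> p'" "c \<noteq> p'" "b \<noteq> c"
      "(p, b) \<in> parcs K" "(p, c) \<in> parcs K"
      using tri unfolding tripod_def by blast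
    then show ?thesis using \<phi>(3) inj by (intro tripodI[of _ _ "\<phi> a" "\<phi> b" "\<phi> c"]) auto
  qed
  have big': "{x1, x2, x3, x4} \<subseteq> ?P \<or>
      (\<exists>p p' q q'. tripod R ?P p p' \<and> tripod R ?P q q' \<and> p \<noteq> q \<and> p' \<noteq> q')"
    using big
  proof
    assume "\<exists>a b c d. {(a, b), (b, c), (c, d), (d, a)} \<subseteq> parcs K \<and> a \<noteq> c \<and> b \<noteq> d"
    then obtain a b c d where abcd: "(a, b) \<in> parcs K" "(b, c) \<in> parcs K" "(c, d) \<in> parcs K"
        "(d, a) \<in> parcs K" "a \<noteq> c" "b \<noteq> d"
      by auto
    then have v: "a \<in> pverts K" "b \<in> pverts K" "c \<in> pverts K" "d \<in> pverts K"
      using Kv by auto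
    have "{\<phi> a, \<phi> b, \<phi> c, \<phi> d} = {x1, x2, x3, x4}"
      using abcd \<phi>(3) inj v by (intro four_cycle_unique) auto
    then show ?thesis using v by auto
  next
    assume "\<exists>p p' q q'. tripod (parcs K) (pverts K) p p' \<and> tripod (parcs K) (pverts K) q q' \<and>
      p \<noteq> q \<and> p' \<noteq> q'"
    then obtain p p' q q' where t: "tripod (parcs K) (pverts K) p p'" "tripod (parcs K) (pverts K) q q'"
        "p \<noteq> q" "p' \<noteq> q'"
      by blast
    then have "\<phi> p \<noteq> \<phi> q" "\<phi> p' \<noteq> \<phi> q'" by (simp_all add: tripod_def inj)
    then show ?thesis using tripod[OF t(1)] tripod[OF t(2)] by blast
  qed
  have sym: "sym (dist3 (parcs K))"
    using K.arcs_symmetric by (intro sym_dist3) (auto simp: sym_def)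
  \<comment> \<open>These are the first two arcs of a path witnessing \<open>dist3\<close>. Its
    third vertex is not \<open>x\<close>, since \<open>x\<close> is nonadjacent to the last
    one.\<close>
  have two: "\<exists>y z. (x, y) \<in> parcs K \<and> (y, z) \<in> parcs K \<and> z \<noteq> x" if x: "x \<in> pverts K" for x
  proof -
    obtain y where y: "(x, y) \<in> (dist3 (parcs K))\<^sup>*" "x \<noteq> y"
      using reach(2)[OF x] reach(2)[OF r(2)] r(3) sym by (metis sym_rtrancl symD)
    then obtain z where "(x, z) \<in> dist3 (parcs K)" by (metis converse_rtranclE)
    then show ?thesis by (auto simp: dist3_def)
  qed
  show ?thesis
  proof (rule connected_if_spanned, rule dist3_grow[of ?P])
    show "?P \<subseteq> V" "\<phi> r \<in> ?P" using \<phi>(2) r by auto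
    show "(\<phi> r, x) \<in> (dist3 R)\<^sup>*" if "x \<in> ?P" for x
      using that copy_reach[of K \<phi>, OF \<phi>(3,4) K(1)] reach(2) by auto
    have "(\<phi> p, \<phi> q) \<in> R \<inter> ?P \<times> ?P" if "(p, q) \<in> parcs K" for p q
      using \<phi>(3) Kv that by blast
    from rtrancl_map[of "parcs K" \<phi>, OF this] show "(\<phi> r, x) \<in> (R \<inter> ?P \<times> ?P)\<^sup>*" if "x \<in> ?P" for x
      using that reach(1) by auto
    show "\<exists>p \<in> ?P. \<exists>q \<in> ?P. (x, p) \<in> R \<and> (p, q) \<in> R \<and> q \<noteq> x" if x: "x \<in> ?P" for x
    proof -
      obtain k where k: "k \<in> pverts K" "x = \<phi> k" using x by auto
      then obtain y z where yz: "(k, y) \<in> parcs K" "(y, z) \<in> parcs K" "z \<noteq> k" using two by blast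
      then have "y \<in> pverts K" "z \<in> pverts K" using Kv by auto
      moreover from this have "\<phi> z \<noteq> x" using inj k yz(3) by auto
      ultimately show ?thesis using \<phi>(3) yz(1,2) k by blast
    qed
  qed (use big' in auto)
qed

end

section \<open>The graphs \<open>G1\<close>, \<open>G2\<close>, \<open>G3\<close> and \<open>H_tree t\<close>\<close>

lemma arcs_G1: "parcs G1 = {(1, 2), (2, 3), (3, 4), (4, 1), (1, 5), (2, 6), (3, 7), (4, 8),
    (2, 1), (3, 2), (4, 3), (1, 4), (5, 1), (6, 2), (7, 3), (8, 4)}"
  by (auto simp: G1_def edge_graph_def)

lemma arcs_G2: "parcs G2 = {(1, 2), (2, 3), (3, 4), (4, 1), (1, 5), (2, 6), (3, 7), (7, 8),
    (2, 1), (3, 2), (4, 3), (1, 4), (5, 1), (6, 2), (7, 3), (8, 7)}"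
  by (auto simp: G2_def edge_graph_def)

lemma arcs_G3: "parcs G3 = {(1, 2), (2, 3), (3, 4), (4, 1), (2, 5), (5, 6), (3, 7), (7, 8),
    (2, 1), (3, 2), (4, 3), (1, 4), (5, 2), (6, 5), (7, 3), (8, 7)}"
  by (auto simp: G3_def edge_graph_def)

lemma verts_G123:
  "pverts G1 = {1, 2, 3, 4, 5, 6, 7, 8}" "pverts G2 = {1, 2, 3, 4, 5, 6, 7, 8}"
  "pverts G3 = {1, 2, 3, 4, 5, 6, 7, 8}"
  by (auto simp: G1_def G2_def G3_def edge_graph_def Field_def)

lemma pair_graph_G123: "pair_graph G1" "pair_graph G2" "pair_graph G3"
  unfolding G1_def G2_def G3_def by (rule pair_graph_edge_graph; simp)+

text \<open>A certificate of reachability that simplification can check: each listed arc starts at a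
  vertex already reached.\<close>

fun tree_list :: "'a set \<Rightarrow> ('a \<times> 'a) list \<Rightarrow> bool" where
  "tree_list S [] \<longleftrightarrow> True"
| "tree_list S (e # es) \<longleftrightarrow> fst e \<in> S \<and> tree_list (insert (snd e) S) es"

lemma tree_list_reach:
  assumes "tree_list {r} es" "set es \<subseteq> A" "x \<in> insert r (snd ` set es)"
  shows "(r, x) \<in> A\<^sup>*"
proof -
  have "(r, x) \<in> A\<^sup>*"
    if "tree_list S es" "\<And>x. x \<in> S \<Longrightarrow> (r, x) \<in> A\<^sup>*" "set es \<subseteq> A" "x \<in> S \<union> snd ` set es" for S
    using that
  proof (induction es arbitrary: S)
    case (Cons e es)
    have "(r, y) \<in> A\<^sup>*" if "y \<in> insert (snd e) S" for y
      using that Cons.prems(1-3) by (cases e) (auto intro: rtrancl_into_rtrancl)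
    then show ?case using Cons.IH[of "insert (snd e) S"] Cons.prems by auto
  qed auto
  from this[of "{r}"] show ?thesis using assms by auto
qed

context four_cycle_graph
begin

lemma connected_if_G1:
  assumes "has_three_induced G G1"
  shows "connected (with_proj (distance3_graph G))"
proof (rule connected_if_copy[OF pair_graph_G123(1) assms, where r = 1 and s = 2])
  show "(\<exists>a b c d. {(a, b), (b, c), (c, d), (d, a)} \<subseteq> parcs G1 \<and> a \<noteq> c \<and> b \<noteq> d) \<or>
    (\<exists>p p' q q'. tripod (parcs G1) (pverts G1) p p' \<and> tripod (parcs G1) (pverts G1) q q' \<and> p \<noteq> q \<and> p' \<noteq> q')"
    by (intro disjI1 exI[of _ 1] exI[of _ 2] exI[of _ 3] exI[of _ 4]) (simp add: arcs_G1)
  show "(1, x) \<in> (parcs G1)\<^sup>*" if "x \<in> pverts G1" for x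
    by (rule tree_list_reach[of 1 "[(1, 2), (2, 3), (3, 4), (1, 5), (2, 6), (3, 7), (4, 8)]"])
      (use that in \<open>simp_all add: verts_G123 arcs_G1\<close>)
  \<comment> \<open>A spanning tree of the 3-distance graph of \<open>G1\<close>; the instances of
    \<open>dist3I\<close> give a path for each of its arcs.\<close>
  have "set [(1, 7), (7, 6), (6, 5), (5, 3), (6, 4), (7, 8), (8, 2)] \<subseteq> dist3 (parcs G1)"
    using
      dist3I[of 1 2 "parcs G1" 3 7]
      dist3I[of 7 3 "parcs G1" 2 6]
      dist3I[of 6 2 "parcs G1" 1 5]
      dist3I[of 5 1 "parcs G1" 2 3]
      dist3I[of 6 2 "parcs G1" 1 4]
      dist3I[of 7 3 "parcs G1" 4 8]
      dist3I[of 8 4 "parcs G1" 3 2]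
    by (simp add: arcs_G1)
  then show "(1, x) \<in> (dist3 (parcs G1))\<^sup>*" if "x \<in> pverts G1" for x
    by (rule tree_list_reach[rotated]) (use that in \<open>auto simp: verts_G123\<close>)
qed (simp_all add: verts_G123)

lemma connected_if_G2:
  assumes "has_three_induced G G2"
  shows "connected (with_proj (distance3_graph G))"
proof (rule connected_if_copy[OF pair_graph_G123(2) assms, where r = 1 and s = 2])
  show "(\<exists>a b c d. {(a, b), (b, c), (c, d), (d, a)} \<subseteq> parcs G2 \<and> a \<noteq> c \<and> b \<noteq> d) \<or>
    (\<exists>p p' q q'. tripod (parcs G2) (pverts G2) p p' \<and> tripod (parcs G2) (pverts G2) q q' \<and> p \<noteq> q \<and> p' \<noteq> q')"
    by (intro disjI1 exI[of _ 1] exI[of _ 2] exI[of _ 3] exI[of _ 4]) (simp add: arcs_G2)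
  show "(1, x) \<in> (parcs G2)\<^sup>*" if "x \<in> pverts G2" for x
    by (rule tree_list_reach[of 1 "[(1, 2), (2, 3), (3, 4), (1, 5), (2, 6), (3, 7), (7, 8)]"])
      (use that in \<open>simp_all add: verts_G123 arcs_G2\<close>)
  have "set [(1, 7), (7, 6), (6, 5), (5, 3), (6, 4), (4, 8), (8, 2)] \<subseteq> dist3 (parcs G2)"
    using
      dist3I[of 1 2 "parcs G2" 3 7]
      dist3I[of 7 3 "parcs G2" 2 6]
      dist3I[of 6 2 "parcs G2" 1 5]
      dist3I[of 5 1 "parcs G2" 2 3]
      dist3I[of 6 2 "parcs G2" 1 4]
      dist3I[of 4 3 "parcs G2" 7 8]
      dist3I[of 8 7 "parcs G2" 3 2]
    by (simp add: arcs_G2)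
  then show "(1, x) \<in> (dist3 (parcs G2))\<^sup>*" if "x \<in> pverts G2" for x
    by (rule tree_list_reach[rotated]) (use that in \<open>auto simp: verts_G123\<close>)
qed (simp_all add: verts_G123)

lemma connected_if_G3:
  assumes "has_three_induced G G3"
  shows "connected (with_proj (distance3_graph G))"
proof (rule connected_if_copy[OF pair_graph_G123(3) assms, where r = 1 and s = 2])
  show "(\<exists>a b c d. {(a, b), (b, c), (c, d), (d, a)} \<subseteq> parcs G3 \<and> a \<noteq> c \<and> b \<noteq> d) \<or>
    (\<exists>p p' q q'. tripod (parcs G3) (pverts G3) p p' \<and> tripod (parcs G3) (pverts G3) q q' \<and> p \<noteq> q \<and> p' \<noteq> q')"
    by (intro disjI1 exI[of _ 1] exI[of _ 2] exI[of _ 3] exI[of _ 4]) (simp add: arcs_G3)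
  show "(1, x) \<in> (parcs G3)\<^sup>*" if "x \<in> pverts G3" for x
    by (rule tree_list_reach[of 1 "[(1, 2), (2, 3), (3, 4), (2, 5), (5, 6), (3, 7), (7, 8)]"])
      (use that in \<open>simp_all add: verts_G123 arcs_G3\<close>)
  have "set [(1, 7), (1, 6), (6, 3), (7, 5), (5, 4), (4, 8), (8, 2)] \<subseteq> dist3 (parcs G3)"
    using
      dist3I[of 1 2 "parcs G3" 3 7]
      dist3I[of 1 2 "parcs G3" 5 6]
      dist3I[of 6 5 "parcs G3" 2 3]
      dist3I[of 7 3 "parcs G3" 2 5]
      dist3I[of 5 2 "parcs G3" 1 4]
      dist3I[of 4 3 "parcs G3" 7 8]
      dist3I[of 8 7 "parcs G3" 3 2]
    by (simp add: arcs_G3)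
  then show "(1, x) \<in> (dist3 (parcs G3))\<^sup>*" if "x \<in> pverts G3" for x
    by (rule tree_list_reach[rotated]) (use that in \<open>auto simp: verts_G123\<close>)
qed (simp_all add: verts_G123)

end

section \<open>The trees \<open>H_t\<close> and their 3-distance graphs\<close>

lemma arcs_H_tree: "(x, y) \<in> parcs (H_tree t) \<longleftrightarrow>
    (x, y) \<in> {(Va 1, Va 2), (Va 2, Vu 0), (Vu t, Vb 2), (Vb 2, Vb 1), (Va 3, Vu 0), (Vb 3, Vu t)} \<or>
    (y, x) \<in> {(Va 1, Va 2), (Va 2, Vu 0), (Vu t, Vb 2), (Vb 2, Vb 1), (Va 3, Vu 0), (Vb 3, Vu t)} \<or>
    (\<exists>i < t. x = Vu i \<and> y = Vu (Suc i) \<or> y = Vu i \<and> x = Vu (Suc i))"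
proof -
  let ?L = "{(Va 1, Va 2), (Va 2, Vu 0), (Vu t, Vb 2), (Vb 2, Vb 1), (Va 3, Vu 0), (Vb 3, Vu t)}"
    and ?U = "{(Vu i, Vu (Suc i)) | i. i < t}"
  have U: "(x, y) \<in> ?U \<longleftrightarrow> (\<exists>i < t. x = Vu i \<and> y = Vu (Suc i))" for x y by blast
  have "(x, y) \<in> parcs (H_tree t) \<longleftrightarrow> ((x, y) \<in> ?L \<or> (x, y) \<in> ?U) \<or> ((y, x) \<in> ?L \<or> (y, x) \<in> ?U)"
    unfolding H_tree_def edge_graph_def pair_pre_digraph.simps Un_iff converse_iff ..
  moreover have "(\<exists>i < t. x = Vu i \<and> y = Vu (Suc i) \<or> y = Vu i \<and> x = Vu (Suc i)) \<longleftrightarrow>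
      (\<exists>i < t. x = Vu i \<and> y = Vu (Suc i)) \<or> (\<exists>i < t. y = Vu i \<and> x = Vu (Suc i))"
    by blast
  ultimately show ?thesis unfolding U by argo
qed

lemma verts_H_tree: "pverts (H_tree t) = {Va 1, Va 2, Va 3, Vb 1, Vb 2, Vb 3} \<union> Vu ` {..t}"
proof -
  have "{Va 1, Va 2, Va 3, Vb 1, Vb 2, Vb 3, Vu 0, Vu t} \<subseteq> pverts (H_tree t)"
    by (auto simp: H_tree_def edge_graph_def Field_def)
  moreover have "Vu i \<in> pverts (H_tree t)" if "i < t" for i
    using that by (auto simp: H_tree_def edge_graph_def Field_def)
  moreover have "pverts (H_tree t) \<subseteq> {Va 1, Va 2, Va 3, Vb 1, Vb 2, Vb 3} \<union> Vu ` {..t}"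
    by (auto simp: H_tree_def edge_graph_def Field_def)
  ultimately show ?thesis by (auto simp: le_less)
qed

lemma pair_graph_H_tree: "pair_graph (H_tree t)"
proof -
  have "finite {(Vu i, Vu (Suc i)) | i. i < t}"
    by (rule finite_subset[of _ "(\<lambda>i. (Vu i, Vu (Suc i))) ` {..<t}"]) auto
  then show ?thesis unfolding H_tree_def by (intro pair_graph_edge_graph) auto
qed

text \<open>The path from \<open>a_1\<close> along the spine to \<open>b_1\<close>, indexed from 0
  to \<open>t + 4\<close>; \<open>u_i\<close> has index \<open>i + 2\<close>.\<close>

definition H_path :: "nat \<Rightarrow> nat \<Rightarrow> h_vertex" where
  "H_path t i = (if i = 0 then Va 1 else if i = 1 then Va 2 else if i \<le> t + 2 then Vu (i - 2)
    else if i = t + 3 then Vb 2 else Vb 1)"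

lemma H_path_arc:
  assumes "i < t + 4"
  shows "(H_path t i, H_path t (Suc i)) \<in> parcs (H_tree t)"
proof -
  have "i = 0 \<or> i = 1 \<or> (\<exists>j < t. i = j + 2) \<or> i = t + 2 \<or> i = t + 3"
    using assms by presburger
  then show ?thesis by (elim disjE exE conjE) (auto simp: H_path_def arcs_H_tree)
qed

lemma H_path_dist3:
  assumes "i \<le> t + 1"
  shows "(H_path t i, H_path t (i + 3)) \<in> dist3 (parcs (H_tree t))"
proof (rule dist3I)
  show "(H_path t i, H_path t (i + 1)) \<in> parcs (H_tree t)" "(H_path t (i + 1), H_path t (i + 2)) \<in> parcs (H_tree t)"
    "(H_path t (i + 2), H_path t (i + 3)) \<in> parcs (H_tree t)"
    using assms H_path_arc[of i t] H_path_arc[of "i + 1" t] H_path_arc[of "i + 2" t] by (simp_all add: numeral_3_eq_3)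
  show "(H_path t i, H_path t (i + 3)) \<notin> parcs (H_tree t)"
    using assms by (auto simp: H_path_def arcs_H_tree split: if_splits)
qed

text \<open>Steps of three along the path join indices of equal residue modulo 3. The vertex
  \<open>a_3\<close> is at distance 3 from indices 0 and 4, joining residues 0 and 1, and
  \<open>b_3\<close> from indices \<open>t\<close> and \<open>t + 4\<close>, joining the residues of
  \<open>t\<close> and \<open>t + 1\<close>. For \<open>t mod 3 \<noteq> 0\<close> the second link
  brings in residue 2.\<close>

lemma H_tree_dist3_reach:
  assumes "t mod 3 \<noteq> 0" "x \<in> pverts (H_tree t)"
  shows "(Va 1, x) \<in> (dist3 (parcs (H_tree t)))\<^sup>*"
proof -
  let ?A = "parcs (H_tree t)" and ?D = "dist3 (parcs (H_tree t))" and ?p = "H_path t"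
  interpret pair_graph "H_tree t" by (rule pair_graph_H_tree)
  have t: "t > 0" using assms(1) by (cases t) auto
  have sym: "sym ?D" using arcs_symmetric by (intro sym_dist3) (auto simp: sym_def)
  have swap: "(y, x) \<in> ?D\<^sup>*" if "(x, y) \<in> ?D\<^sup>*" for x y
    using that sym by (metis sym_rtrancl symD)
  have mod3: "(?p (i mod 3), ?p i) \<in> ?D\<^sup>*" if "i \<le> t + 4" for i
    using that
  proof (induction i rule: less_induct)
    case (less i)
    show ?case
    proof (cases "i < 3")
      case False
      then have "(?p ((i - 3) mod 3), ?p (i - 3)) \<in> ?D\<^sup>*" using less by simp
      moreover have "(?p (i - 3), ?p i) \<in> ?D" using H_path_dist3[of "i - 3" t] False less(2) by simp
      moreover have "(i - 3) mod 3 = i mod 3" using False by (simp add: mod_if)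
      ultimately show ?thesis by (metis rtrancl.rtrancl_into_rtrancl)
    qed simp
  qed
  have arcs: "(Va 3, Vu 0) \<in> ?A" "(Vu 0, ?p 1) \<in> ?A" "(?p 1, ?p 0) \<in> ?A" "(Vu 0, ?p 3) \<in> ?A"
      "(?p 3, ?p 4) \<in> ?A" "(Vb 3, Vu t) \<in> ?A" "(Vu t, ?p (t + 3)) \<in> ?A" "(?p (t + 3), ?p (t + 4)) \<in> ?A"
      "(Vu t, ?p (t + 1)) \<in> ?A" "(?p (t + 1), ?p t) \<in> ?A"
  proof -
    have "H_path t (t + 1) = Vu (t - 1)" using t by (simp add: H_path_def)
    moreover have "(Vu t, Vu (t - 1)) \<in> ?A" using t by (auto simp: arcs_H_tree intro: exI[of _ "t - 1"])
    ultimately show "(Vu t, ?p (t + 1)) \<in> ?A" by simp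
    show "(?p (t + 1), ?p t) \<in> ?A" using arcs_symmetric[OF H_path_arc[of t t]] by simp
    show "(?p 3, ?p 4) \<in> ?A" using H_path_arc[of 3 t] t by simp
    show "(?p (t + 3), ?p (t + 4)) \<in> ?A" using H_path_arc[of "t + 3" t] by (simp add: add.commute)
    have "H_path t 3 = Vu 1" using t by (simp add: H_path_def)
    then show "(Vu 0, ?p 3) \<in> ?A" using t by (simp add: arcs_H_tree)
  qed (simp_all add: arcs_H_tree H_path_def)
  have a3: "(Va 3, ?p 0) \<in> ?D"
    by (rule dist3I[OF arcs(1-3)]) (simp add: H_path_def arcs_H_tree)
  have a3': "(Va 3, ?p 4) \<in> ?D"
    by (rule dist3I[OF arcs(1,4,5)]) (use t in \<open>auto simp: H_path_def arcs_H_tree split: if_splits\<close>)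
  have b3: "(Vb 3, ?p (t + 4)) \<in> ?D"
    by (rule dist3I[OF arcs(6-8)]) (simp add: H_path_def arcs_H_tree)
  have b3': "(Vb 3, ?p t) \<in> ?D"
    by (rule dist3I[OF arcs(6,9,10)]) (use t in \<open>auto simp: H_path_def arcs_H_tree split: if_splits\<close>)
  note trans = rtrancl_trans[where r = ?D]
  have 1: "(?p 0, ?p 1) \<in> ?D\<^sup>*"
    using trans[OF swap[OF r_into_rtrancl[OF a3]] trans[OF r_into_rtrancl[OF a3'] swap[OF mod3[of 4]]]] t by simp
  have b: "(?p (t mod 3), ?p (Suc t mod 3)) \<in> ?D\<^sup>*"
  proof -
    have "(t + 4) mod 3 = Suc t mod 3" by presburger
    then show ?thesis
      using trans[OF mod3[of t] trans[OF swap[OF r_into_rtrancl[OF b3']]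
        trans[OF r_into_rtrancl[OF b3] swap[OF mod3[of "t + 4"]]]]] by simp
  qed
  have 2: "(?p 0, ?p 2) \<in> ?D\<^sup>*"
  proof -
    have "t mod 3 = 1 \<and> Suc t mod 3 = 2 \<or> t mod 3 = 2 \<and> Suc t mod 3 = 0"
      using assms(1) by presburger
    then show ?thesis using b swap trans[OF 1] by auto
  qed
  have p: "(?p 0, ?p i) \<in> ?D\<^sup>*" if "i \<le> t + 4" for i
  proof -
    have "i mod 3 = 0 \<or> i mod 3 = 1 \<or> i mod 3 = 2" by presburger
    then have "(?p 0, ?p (i mod 3)) \<in> ?D\<^sup>*" using 1 2 by auto
    then show ?thesis using mod3[OF that] by (rule trans)
  qed
  have pts: "Va 1 = ?p 0" "Va 2 = ?p 1" "Vb 2 = ?p (t + 3)" "Vb 1 = ?p (t + 4)"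
      "\<And>i. i \<le> t \<Longrightarrow> Vu i = ?p (i + 2)"
    by (simp_all add: H_path_def)
  have "(?p 0, Va 3) \<in> ?D\<^sup>*" by (rule swap[OF r_into_rtrancl[OF a3]])
  moreover have "(?p 0, Vb 3) \<in> ?D\<^sup>*" by (rule trans[OF p[of "t + 4"] swap[OF r_into_rtrancl[OF b3]]]) simp
  moreover have "(?p 0, Vu i) \<in> ?D\<^sup>*" if "i \<le> t" for i using p[of "i + 2"] pts(5)[OF that] that by simp
  moreover have "(?p 0, Va 1) \<in> ?D\<^sup>*" "(?p 0, Va 2) \<in> ?D\<^sup>*" "(?p 0, Vb 2) \<in> ?D\<^sup>*" "(?p 0, Vb 1) \<in> ?D\<^sup>*"
    unfolding pts(1-4) by (rule p; simp)+
  ultimately have "(?p 0, x) \<in> ?D\<^sup>*"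
    using assms(2) unfolding verts_H_tree by (elim UnE insertE imageE) simp_all
  then show ?thesis by (simp only: pts(1))
qed

lemma H_tree_reach:
  assumes "x \<in> pverts (H_tree t)"
  shows "(Va 1, x) \<in> (parcs (H_tree t))\<^sup>*"
proof -
  let ?A = "parcs (H_tree t)"
  have p: "(H_path t 0, H_path t i) \<in> ?A\<^sup>*" if "i \<le> t + 4" for i
    using that
  proof (induction i)
    case (Suc i)
    then show ?case using H_path_arc[of i t] by (auto intro: rtrancl_into_rtrancl)
  qed simp
  have pts: "Va 1 = H_path t 0" "Va 2 = H_path t 1" "Vb 2 = H_path t (t + 3)" "Vb 1 = H_path t (t + 4)"
    "\<And>i. i \<le> t \<Longrightarrow> Vu i = H_path t (i + 2)"
    by (simp_all add: H_path_def)
  then have u: "(Va 1, Vu i) \<in> ?A\<^sup>*" if "i \<le> t" for i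
    using p[of "i + 2"] that by simp
  have "(Vu 0, Va 3) \<in> ?A" "(Vu t, Vb 3) \<in> ?A" by (simp_all add: arcs_H_tree)
  then have "(Va 1, Va 3) \<in> ?A\<^sup>*" "(Va 1, Vb 3) \<in> ?A\<^sup>*"
    using u[of 0] u[of t] by (auto intro: rtrancl_into_rtrancl)
  moreover have "(Va 1, Va 2) \<in> ?A\<^sup>*" "(Va 1, Vb 2) \<in> ?A\<^sup>*" "(Va 1, Vb 1) \<in> ?A\<^sup>*"
    using p[of 1] p[of "t + 3"] p[of "t + 4"] pts(1-4) by simp_all
  ultimately show ?thesis
    using assms u unfolding verts_H_tree by auto
qed

lemma (in four_cycle_graph) connected_if_H_tree:
  assumes "has_three_induced G (H_tree t)" "t mod 3 \<noteq> 0"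
  shows "connected (with_proj (distance3_graph G))"
proof (rule connected_if_copy[OF pair_graph_H_tree assms(1), where r = "Va 1" and s = "Va 2"])
  let ?A = "parcs (H_tree t)" and ?V = "pverts (H_tree t)"
  have t: "t > 0" using assms(2) by (cases t) auto
  \<comment> \<open>With no cycle in \<open>H_t\<close>, the two tripods at the ends of the spine
    meet the size condition.\<close>
  have "tripod ?A ?V (Vu 0) (Va 2)"
    by (rule tripodI[of _ _ "Va 1" "Va 3" "Vu 1"])
      (use t in \<open>simp_all add: arcs_H_tree verts_H_tree image_iff\<close>)
  moreover have "tripod ?A ?V (Vu t) (Vb 2)"
    by (rule tripodI[of _ _ "Vb 1" "Vb 3" "Vu (t - 1)"])
      (use t in \<open>auto simp: arcs_H_tree verts_H_tree intro: exI[of _ "t - 1"]\<close>)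
  moreover have "Vu 0 \<noteq> Vu t" using t by simp
  ultimately show "(\<exists>a b c d. {(a, b), (b, c), (c, d), (d, a)} \<subseteq> ?A \<and> a \<noteq> c \<and> b \<noteq> d) \<or>
    (\<exists>p p' q q'. tripod ?A ?V p p' \<and> tripod ?A ?V q q' \<and> p \<noteq> q \<and> p' \<noteq> q')"
    by blast
  show "Va 1 \<in> ?V" "Va 2 \<in> ?V" by (simp_all add: verts_H_tree)
  show "Va 1 \<noteq> Va 2" by simp
  show "(Va 1, x) \<in> ?A\<^sup>*" if "x \<in> ?V" for x using that by (rule H_tree_reach)
  show "(Va 1, x) \<in> (dist3 ?A)\<^sup>*" if "x \<in> ?V" for x using assms(2) that by (rule H_tree_dist3_reach)
qed

section \<open>Copies forced by connectedness\<close>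

definition pendant :: "('a \<times> 'a) set \<Rightarrow> 'a set \<Rightarrow> 'a \<Rightarrow> bool" where
  "pendant R C x \<longleftrightarrow> (\<exists>a. (x, a) \<in> R \<and> a \<notin> C)"

text \<open>If \<open>C\<close> is the vertex set of the only cycle and \<open>x\<close> lies on it,
  then \<open>b\<close> is off the cycle too: a path of length 2 hangs at \<open>x\<close>.\<close>

definition deep :: "('a \<times> 'a) set \<Rightarrow> 'a set \<Rightarrow> 'a \<Rightarrow> bool" where
  "deep R C x \<longleftrightarrow> (\<exists>a b. (x, a) \<in> R \<and> a \<notin> C \<and> (a, b) \<in> R \<and> b \<noteq> x)"

lemma inj_on_nth_pred:
  assumes "distinct xs"
  shows "inj_on (\<lambda>k. xs ! (k - 1)) {1..length xs}"
  using assms by (auto simp: inj_on_def nth_eq_iff_index_eq)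

context four_cycle_graph
begin

abbreviation "C \<equiv> {x1, x2, x3, x4}"

lemma C_in_V: "x1 \<in> V" "x2 \<in> V" "x3 \<in> V" "x4 \<in> V"
  using in_arcsD1 cyc by auto

text \<open>The eight listed vertices are closed under the parent map \<open>f\<close>.\<close>

lemma has_three_induced_G123:
  assumes K: "pair_graph K" "pverts K = {1, 2, 3, 4, 5, 6, 7, 8}"
    and f: "f x1 = x2" "f x2 = x3" "f x3 = x4" "f x4 = x1" "\<And>a b. (a, b) \<in> R \<Longrightarrow> f a = b \<or> f b = a"
      "\<And>v. v \<in> V \<Longrightarrow> \<exists>n. (f ^^ n) v = x4"
    and dist8: "distinct [x1, x2, x3, x4, a5, a6, a7, a8]"
    and \<phi>: "\<phi> = (\<lambda>k :: nat. [x1, x2, x3, x4, a5, a6, a7, a8] ! (k - 1))"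
    and hom: "\<And>a b. (a, b) \<in> parcs K \<Longrightarrow> (\<phi> a, \<phi> b) \<in> R"
    and cyc_K: "(1, 2) \<in> parcs K" "(2, 3) \<in> parcs K" "(3, 4) \<in> parcs K" "(4, 1) \<in> parcs K"
    and par: "(5, pa) \<in> parcs K" "f a5 = \<phi> pa" "(6, pb) \<in> parcs K" "f a6 = \<phi> pb"
      "(7, pc) \<in> parcs K" "f a7 = \<phi> pc" "(8, pd) \<in> parcs K" "f a8 = \<phi> pd"
  shows "has_three_induced G K"
proof (rule has_three_induced_closed[where f = f and \<theta> = "\<lambda>x. x" and \<phi> = \<phi>])
  interpret K: pair_graph K by fact
  have "pverts K = {1..length [x1, x2, x3, x4, a5, a6, a7, a8]}" unfolding K(2) by auto
  then show "inj_on \<phi> (pverts K)" using inj_on_nth_pred[OF dist8] by (simp add: \<phi>)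
  have par': "\<exists>b. (a, b) \<in> parcs K \<and> f (\<phi> a) = \<phi> b" if "a \<in> pverts K" for a
  proof -
    have "\<phi> 1 = x1" "\<phi> 2 = x2" "\<phi> 3 = x3" "\<phi> 4 = x4" by (simp_all add: \<phi>)
    moreover have "\<phi> 5 = a5" "\<phi> 6 = a6" "\<phi> 7 = a7" "\<phi> 8 = a8" by (simp_all add: \<phi>)
    ultimately have "f (\<phi> 1) = \<phi> 2" "f (\<phi> 2) = \<phi> 3" "f (\<phi> 3) = \<phi> 4" "f (\<phi> 4) = \<phi> 1"
        "f (\<phi> 5) = \<phi> pa" "f (\<phi> 6) = \<phi> pb" "f (\<phi> 7) = \<phi> pc" "f (\<phi> 8) = \<phi> pd"
      using f(1-4) par by simp_all
    then show ?thesis using that cyc_K par unfolding K(2) by blast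
  qed
  then show "f (\<phi> a) = \<phi> a \<or> (\<exists>b. (a, b) \<in> parcs K \<and> f (\<phi> a) = \<phi> b)" if "a \<in> pverts K" for a
    using that by blast
  show "\<phi> a \<in> V \<and> \<phi> a = \<phi> a" if "a \<in> pverts K" for a
    using par'[OF that] hom in_arcsD1 by blast
  show "\<exists>n. (f ^^ n) v \<in> \<phi> ` pverts K" if "v \<in> V" for v
  proof -
    have "x4 = \<phi> 4" "4 \<in> pverts K" unfolding K(2) by (simp_all add: \<phi>)
    then show ?thesis using f(6)[OF that] by (metis imageI)
  qed
qed (use K pair_graph hom f(5) in auto)

text \<open>The parent map sends each chosen off-cycle neighbour to its cycle vertex, so different
  parents prove the eight vertices distinct. \<open>has_G2\<close> and \<open>has_G3\<close> proceed
  likewise.\<close>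

lemma has_G1:
  assumes "pendant R C x1" "pendant R C x2" "pendant R C x3" "pendant R C x4"
  shows "has_three_induced G G1"
proof -
  obtain a1 a2 a3 a4 where a: "(x1, a1) \<in> R" "a1 \<notin> C" "(x2, a2) \<in> R" "a2 \<notin> C"
      "(x3, a3) \<in> R" "a3 \<notin> C" "(x4, a4) \<in> R" "a4 \<notin> C"
    using assms by (auto simp: pendant_def)
  obtain f where f: "f x1 = x2" "f x2 = x3" "f x3 = x4" "f x4 = x1"
    "\<And>a b. (a, b) \<in> R \<Longrightarrow> f a = b \<or> f b = a" "\<And>v. v \<in> V \<Longrightarrow> \<exists>n. (f ^^ n) v = x4"
    using parent_map by blast
  have fa: "f a1 = x1" "f a2 = x2" "f a3 = x3" "f a4 = x4"
    using f(5)[OF a(1)] f(5)[OF a(3)] f(5)[OF a(5)] f(5)[OF a(7)] f(1-4) a by auto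
  have d: "distinct [x1, x2, x3, x4, a1, a2, a3, a4]"
    using dist a fa by auto
  show ?thesis
  proof (rule has_three_induced_G123[OF pair_graph_G123(1) verts_G123(1) f d refl, where pa = 1 and pb = 2 and pc = 3 and pd = 4])
    fix i j :: nat
    note arcs = cyc cyc' a(1) a(3) a(5) a(7) a(1)[THEN R_sym] a(3)[THEN R_sym] a(5)[THEN R_sym] a(7)[THEN R_sym]
    assume "(i, j) \<in> parcs G1"
    then show "([x1, x2, x3, x4, a1, a2, a3, a4] ! (i - 1), [x1, x2, x3, x4, a1, a2, a3, a4] ! (j - 1)) \<in> R"
      unfolding arcs_G1 by (elim insertE emptyE Pair_inject; simp add: arcs)
  qed (simp_all add: arcs_G1 fa)
qed

lemma has_G2:
  assumes "pendant R C x1" "pendant R C x2" "deep R C x3"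
  shows "has_three_induced G G2"
proof -
  obtain a1 a2 p q where a: "(x1, a1) \<in> R" "a1 \<notin> C" "(x2, a2) \<in> R" "a2 \<notin> C"
      "(x3, p) \<in> R" "p \<notin> C" "(p, q) \<in> R" "q \<noteq> x3"
    using assms by (auto simp: pendant_def deep_def)
  obtain f where f: "f x1 = x2" "f x2 = x3" "f x3 = x4" "f x4 = x1"
    "\<And>a b. (a, b) \<in> R \<Longrightarrow> f a = b \<or> f b = a" "\<And>v. v \<in> V \<Longrightarrow> \<exists>n. (f ^^ n) v = x4"
    using parent_map by blast
  have fa: "f a1 = x1" "f a2 = x2" "f p = x3"
    using f(5)[OF a(1)] f(5)[OF a(3)] f(5)[OF a(5)] f(1-4) a by auto
  then have fq: "f q = p" using f(5)[OF a(7)] a(8) by auto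
  have d: "distinct [x1, x2, x3, x4, a1, a2, p, q]"
    using dist a fa fq f(1-4) no_loops' by auto
  show ?thesis
  proof (rule has_three_induced_G123[OF pair_graph_G123(2) verts_G123(2) f d refl, where pa = 1 and pb = 2 and pc = 3 and pd = 7])
    fix i j :: nat
    note arcs = cyc cyc' a(1) a(3) a(5) a(7) a(1)[THEN R_sym] a(3)[THEN R_sym] a(5)[THEN R_sym] a(7)[THEN R_sym]
    assume "(i, j) \<in> parcs G2"
    then show "([x1, x2, x3, x4, a1, a2, p, q] ! (i - 1), [x1, x2, x3, x4, a1, a2, p, q] ! (j - 1)) \<in> R"
      unfolding arcs_G2 by (elim insertE emptyE Pair_inject; simp add: arcs)
  qed (simp_all add: arcs_G2 fa fq)
qed

lemma has_G3:
  assumes "deep R C x2" "deep R C x3"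
  shows "has_three_induced G G3"
proof -
  obtain p q p' q' where a: "(x2, p) \<in> R" "p \<notin> C" "(p, q) \<in> R" "q \<noteq> x2"
      "(x3, p') \<in> R" "p' \<notin> C" "(p', q') \<in> R" "q' \<noteq> x3"
    using assms by (auto simp: deep_def)
  obtain f where f: "f x1 = x2" "f x2 = x3" "f x3 = x4" "f x4 = x1"
    "\<And>a b. (a, b) \<in> R \<Longrightarrow> f a = b \<or> f b = a" "\<And>v. v \<in> V \<Longrightarrow> \<exists>n. (f ^^ n) v = x4"
    using parent_map by blast
  have fa: "f p = x2" "f p' = x3"
    using f(5)[OF a(1)] f(5)[OF a(5)] f(1-4) a by auto
  then have fq: "f q = p" "f q' = p'" using f(5)[OF a(3)] f(5)[OF a(7)] a(4,8) by auto
  have d: "distinct [x1, x2, x3, x4, p, q, p', q']"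
    using dist a fa fq f(1-4) no_loops' by auto
  show ?thesis
  proof (rule has_three_induced_G123[OF pair_graph_G123(3) verts_G123(3) f d refl, where pa = 2 and pb = 5 and pc = 3 and pd = 7])
    fix i j :: nat
    note arcs = cyc cyc' a(1) a(3) a(5) a(7) a(1)[THEN R_sym] a(3)[THEN R_sym] a(5)[THEN R_sym] a(7)[THEN R_sym]
    assume "(i, j) \<in> parcs G3"
    then show "([x1, x2, x3, x4, p, q, p', q'] ! (i - 1), [x1, x2, x3, x4, p, q, p', q'] ! (j - 1)) \<in> R"
      unfolding arcs_G3 by (elim insertE emptyE Pair_inject; simp add: arcs)
  qed (simp_all add: arcs_G3 fa fq)
qed

section \<open>Copies of \<open>H_t\<close> in the tree left after deleting
  \<open>x4\<close>\<close>

abbreviation "W \<equiv> V - {x4}"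
abbreviation "RW \<equiv> R \<inter> W \<times> W"

text \<open>Folding \<open>x4\<close> onto the opposite vertex retracts \<open>G\<close> onto the tree \<open>G - x4\<close>.\<close>

abbreviation "fold4 \<equiv> (\<lambda>x. x)(x4 := x2)"

text \<open>The remaining cycle vertex \<open>x2\<close> has the colour of \<open>x4\<close>, hence
  is not adjacent to it.\<close>

lemma nbr_x4:
  assumes "\<not> pendant R C x4" "(x4, a) \<in> R"
  shows "a = x1 \<or> a = x3"
proof -
  obtain c :: "'a \<Rightarrow> bool" where c: "\<And>a b. (a, b) \<in> R \<Longrightarrow> c a \<noteq> c b" using bipartite by blast
  have "a \<in> C" using assms by (auto simp: pendant_def)
  moreover have "c a \<noteq> c x4" "c x2 = c x4" using c[OF assms(2)] c[OF cyc(1)] c[OF cyc(4)] by auto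
  ultimately show ?thesis by auto
qed

text \<open>\<open>x2\<close> is adjacent to both neighbours of \<open>x4\<close>, so arcs at
  \<open>x4\<close> become arcs at \<open>x2\<close>.\<close>

lemma fold4_arc:
  assumes "\<not> pendant R C x4" "(x, y) \<in> R"
  shows "(fold4 x, fold4 y) \<in> RW"
proof -
  have V: "x \<in> V" "y \<in> V" "x \<noteq> y" using assms(2) in_arcsD1 in_arcsD2 no_loops' by auto
  consider "x = x4" | "y = x4" | "x \<noteq> x4" "y \<noteq> x4" by blast
  then show ?thesis
  proof cases
    case 1
    then have "y = x1 \<or> y = x3" using nbr_x4 assms by auto
    then show ?thesis using 1 dist cyc(2) cyc'(1) C_in_V by auto
  next
    case 2
    then have "x = x1 \<or> x = x3" using nbr_x4 assms R_sym by blast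
    then show ?thesis using 2 dist cyc(1) cyc'(2) C_in_V by auto
  next
    case 3
    then show ?thesis using V assms(2) by auto
  qed
qed

text \<open>Folding a walk of \<open>G\<close> yields a walk that avoids \<open>x4\<close>, so
  deleting \<open>x4\<close> leaves the graph connected.\<close>

lemma rooted_tree_W:
  assumes "\<not> pendant R C x4" "u \<in> W"
  shows "\<exists>g l. rooted_tree W RW u g l"
proof (rule rooted_tree_exists)
  fix v assume v: "v \<in> W"
  have "(u, v) \<in> R\<^sup>*" using conn assms(2) v by auto
  from rtrancl_map[of R fold4 RW, OF fold4_arc[OF assms(1)] this]
  show "(u, v) \<in> RW\<^sup>*" using assms(2) v by auto
qed (use R_sym assms(2) in \<open>auto simp: sym_def\<close>)

text \<open>The spine consists of the ancestors of \<open>w\<close>. That its level-1 vertex differs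
  from \<open>a2\<close> and \<open>a3\<close> keeps it away from the tripod at the root. The copy
  is closed under parents, so \<open>has_three_induced_closed\<close> applies with
  \<open>\<theta> = fold4\<close>.\<close>

lemma has_H_tree:
  assumes x4: "\<not> pendant R C x4" and T: "rooted_tree W RW u g l"
    and a: "{a1, a2, a3} \<subseteq> W" "g a2 = u" "g a3 = u" "g a1 = a2" "a2 \<noteq> u" "a3 \<noteq> u" "a2 \<noteq> a3"
    and w: "rooted_tree.branching W u g w s t t'" "l w = Suc n" "(g ^^ n) w \<noteq> a2" "(g ^^ n) w \<noteq> a3"
  shows "has_three_induced G (H_tree (Suc n))"
proof -
  interpret T: rooted_tree W RW u g l by fact
  have st: "{w, s, t, t'} \<subseteq> W" "u \<notin> {s, t, t'}" "g s = w" "g t = w" "s \<noteq> t" "g t' = t"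
    using w(1) by (auto simp: T.branching_def)
  \<comment> \<open>\<open>U i\<close> is the ancestor of \<open>w\<close> at level
    \<open>i\<close>.\<close>
  define U where "U i = (g ^^ (Suc n - i)) w" for i
  have U_W: "U i \<in> W" for i using st(1) T.funpow_g_in by (simp add: U_def)
  have U_l: "l (U i) = i" if "i \<le> Suc n" for i
    using T.funpow_g_level[of w "Suc n - i"] st(1) w(2) that by (simp add: U_def)
  have U_g: "g (U (Suc i)) = U i" if "i \<le> n" for i
    using that by (simp add: U_def Suc_diff_le)
  have U_ends: "U 0 = u" "U (Suc n) = w" "U 1 = (g ^^ n) w"
    using T.funpow_g_root[of w] st(1) w(2) by (simp_all add: U_def)
  have "a1 \<noteq> u" using a(4,5) T.root(2) by auto
  have la: "l a2 = 1" "l a3 = 1" "l a1 = 2"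
    using T.parent[of a2] T.parent[of a3] T.parent[of a1] a \<open>a1 \<noteq> u\<close> T.root(3) by simp_all
  have st': "s \<noteq> u" "t \<noteq> u" "t' \<noteq> u" using st(2) by auto
  then have lb: "l s = n + 2" "l t = n + 2" "l t' = n + 3"
    using T.parent[of s] T.parent[of t] T.parent[of t'] st w(2) by simp_all
  have Un: "U i \<noteq> a2 \<and> U i \<noteq> a3 \<and> U i \<noteq> a1 \<and> U i \<noteq> s \<and> U i \<noteq> t \<and> U i \<noteq> t'" if i: "i \<le> Suc n" for i
  proof -
    have "U i \<noteq> x" if "l x \<noteq> i" for x using U_l[OF i] that by auto
    moreover have "U 1 \<noteq> a2" "U 1 \<noteq> a3" using U_ends(3) w(3,4) by simp_all
    \<comment> \<open>Levels separate the spine from the legs except at levels 1 and 2; at level 2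
      the parents \<open>U 1\<close> and \<open>a2\<close> differ.\<close>
    moreover have "U 2 \<noteq> a1" if "1 \<le> n" using U_g[of 1] a(4) that w(3) U_ends(3) by (auto simp: numeral_2_eq_2)
    ultimately show ?thesis using la lb i by (cases "i = 1"; cases "i = 2") auto
  qed
  have ab: "distinct [a1, a2, a3, s, t, t']"
  proof -
    have neq: "x \<noteq> y" if "l x \<noteq> l y" for x y using that by auto
    have "a1 \<noteq> s" "a1 \<noteq> t"
    proof -
      \<comment> \<open>For \<open>n = 0\<close> the vertices \<open>a1\<close>, \<open>s\<close>,
        \<open>t\<close> share level 2, and only their parents tell them apart.\<close>
      have "g a1 \<noteq> w" if "n = 0" using that a(4) w(3) U_ends by auto
      then show "a1 \<noteq> s" "a1 \<noteq> t" using la lb st(3,4) by auto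
    qed
    moreover have "a1 \<noteq> a2" "a1 \<noteq> a3" "a1 \<noteq> t'" "a2 \<noteq> s" "a2 \<noteq> t" "a2 \<noteq> t'" "a3 \<noteq> s" "a3 \<noteq> t" "a3 \<noteq> t'"
      "s \<noteq> t'" "t \<noteq> t'"
      by (rule neq; simp add: la lb)+
    ultimately show ?thesis using a(7) st(5) by simp
  qed
  define \<phi> where "\<phi> z = (case z of Vu i \<Rightarrow> U i | Va k \<Rightarrow> (if k = 1 then a1 else if k = 2 then a2 else a3)
    | Vb k \<Rightarrow> (if k = 1 then t' else if k = 2 then t else s))" for z
  have \<phi>s: "\<phi> (Va 1) = a1" "\<phi> (Va 2) = a2" "\<phi> (Va 3) = a3" "\<phi> (Vb 1) = t'" "\<phi> (Vb 2) = t" "\<phi> (Vb 3) = s"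
    "\<And>i. \<phi> (Vu i) = U i"
    by (simp_all add: \<phi>_def)
  have \<phi>W: "\<phi> z \<in> W" for z
    using a(1) st(1) U_W by (simp add: \<phi>_def split: h_vertex.split)
  let ?K = "H_tree (Suc n)"
  have g_arc: "(x, g x) \<in> R" "(g x, x) \<in> R" if "x \<in> W" "x \<noteq> u" for x
    using T.parent[OF that] R_sym by auto
  have up: "\<phi> z \<noteq> u \<and> (\<exists>z'. (z, z') \<in> parcs ?K \<and> g (\<phi> z) = \<phi> z')" if z: "z \<in> pverts ?K" "z \<noteq> Vu 0" for z
  proof -
    have "z \<in> {Va 1, Va 2, Va 3, Vb 1, Vb 2, Vb 3} \<or> (\<exists>i \<le> n. z = Vu (Suc i))"
      using z unfolding verts_H_tree by (auto simp: gr0_conv_Suc) (metis Suc_le_mono not0_implies_Suc)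
    then show ?thesis
    proof
      assume "z \<in> {Va 1, Va 2, Va 3, Vb 1, Vb 2, Vb 3}"
      moreover have "\<phi> z \<noteq> u" if "z = Va 1 \<or> z = Va 2 \<or> z = Va 3 \<or> z = Vb 1 \<or> z = Vb 2 \<or> z = Vb 3"
        using that a(5,6) \<open>a1 \<noteq> u\<close> st(2) \<phi>s by auto
      moreover have "g (\<phi> (Va 1)) = \<phi> (Va 2)" "g (\<phi> (Va 2)) = \<phi> (Vu 0)" "g (\<phi> (Va 3)) = \<phi> (Vu 0)"
        "g (\<phi> (Vb 1)) = \<phi> (Vb 2)" "g (\<phi> (Vb 2)) = \<phi> (Vu (Suc n))" "g (\<phi> (Vb 3)) = \<phi> (Vu (Suc n))"
        unfolding \<phi>s using a(2-4) st(3,4,6) U_ends by simp_all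
      moreover have "{(Va 1, Va 2), (Va 2, Vu 0), (Va 3, Vu 0), (Vb 1, Vb 2), (Vb 2, Vu (Suc n)),
          (Vb 3, Vu (Suc n))} \<subseteq> parcs ?K"
        by (simp add: arcs_H_tree)
      ultimately show ?thesis by blast
    next
      assume "\<exists>i \<le> n. z = Vu (Suc i)"
      then obtain i where i: "i \<le> n" "z = Vu (Suc i)" by blast
      have "U (Suc i) \<noteq> u" using U_l[of "Suc i"] i T.root(3) by auto
      moreover have "(Vu (Suc i), Vu i) \<in> parcs ?K" using i by (auto simp: arcs_H_tree intro: exI[of _ i])
      ultimately show ?thesis using i U_g[of i] \<phi>s(7) by metis
    qed
  qed
  show ?thesis
  proof (rule has_three_induced_closed[where f = g and \<theta> = fold4 and \<phi> = \<phi>])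
    interpret K: pair_graph ?K by (rule pair_graph_H_tree)
    show "g (fold4 x) = fold4 y \<or> g (fold4 y) = fold4 x" if "(x, y) \<in> R" for x y
      using T.arc[OF fold4_arc[OF x4 that]] by metis
    show "\<exists>m. (g ^^ m) (fold4 v) \<in> \<phi> ` pverts ?K" if "v \<in> V" for v
    proof -
      have "fold4 v \<in> W" using that C_in_V dist by auto
      then have "(g ^^ l (fold4 v)) (fold4 v) = \<phi> (Vu 0)"
        using T.funpow_g_root U_ends \<phi>s(7) by metis
      moreover have "Vu 0 \<in> pverts ?K" by (simp add: verts_H_tree)
      ultimately show ?thesis by (metis imageI)
    qed
    show "inj_on \<phi> (pverts ?K)"
    proof (rule inj_on_inverseI)
      \<comment> \<open>An explicit left inverse of \<open>\<phi>\<close>: the six leg vertices are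
        recognised by name, the spine by level.\<close>
      define \<psi> where "\<psi> x = (if x = t' then Vb 1 else if x = t then Vb 2 else if x = s then Vb 3
        else if x = a3 then Va 3 else if x = a2 then Va 2 else if x = a1 then Va 1 else Vu (l x))" for x
      fix z assume "z \<in> pverts ?K"
      then consider "z = Va 1" | "z = Va 2" | "z = Va 3" | "z = Vb 1" | "z = Vb 2" | "z = Vb 3"
        | i where "i \<le> Suc n" "z = Vu i"
        unfolding verts_H_tree by blast
      then show "\<psi> (\<phi> z) = z"
      proof cases
        case 7
        then show ?thesis using Un[OF 7(1)] U_l[OF 7(1)] by (simp add: \<psi>_def \<phi>s)
      qed (use ab in \<open>simp_all add: \<psi>_def \<phi>_def\<close>)
    qed
    show "\<phi> z \<in> V \<and> fold4 (\<phi> z) = \<phi> z" if "z \<in> pverts ?K" for z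
      using \<phi>W[of z] by auto
    show "g (\<phi> z) = \<phi> z \<or> (\<exists>z'. (z, z') \<in> parcs ?K \<and> g (\<phi> z) = \<phi> z')" if "z \<in> pverts ?K" for z
      using up[OF that] T.root(2) U_ends(1) \<phi>s(7) by metis
    show "(\<phi> y, \<phi> z) \<in> R" if "(y, z) \<in> parcs ?K" for y z
    proof -
      have E: "(\<phi> y, \<phi> z) \<in> R \<and> (\<phi> z, \<phi> y) \<in> R" if "g (\<phi> y) = \<phi> z" "\<phi> y \<noteq> u" for y z
        using g_arc[OF \<phi>W[of y] that(2)] that(1) by simp
      have U_u: "U (Suc i) \<noteq> u" if "i \<le> n" for i using U_l[of "Suc i"] that T.root(3) by auto
      note arcs = E[of "Va 1" "Va 2"] E[of "Va 2" "Vu 0"] E[of "Va 3" "Vu 0"] E[of "Vb 1" "Vb 2"]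
        E[of "Vb 2" "Vu (Suc n)"] E[of "Vb 3" "Vu (Suc n)"]
      have A: "(\<phi> y, \<phi> z) \<in> R \<and> (\<phi> z, \<phi> y) \<in> R"
        if "(y, z) \<in> {(Va 1, Va 2), (Va 2, Vu 0), (Vu (Suc n), Vb 2), (Vb 2, Vb 1), (Va 3, Vu 0), (Vb 3, Vu (Suc n))}" for y z
        using that arcs by (elim insertE emptyE Pair_inject) (simp_all only: \<phi>s a st U_ends st' \<open>a1 \<noteq> u\<close> simp_thms)
      have B: "(\<phi> (Vu i), \<phi> (Vu (Suc i))) \<in> R \<and> (\<phi> (Vu (Suc i)), \<phi> (Vu i)) \<in> R" if "i < Suc n" for i
        using E[of "Vu (Suc i)" "Vu i"] U_g[of i] U_u[of i] that by (simp add: \<phi>s)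
      show ?thesis using that A[of y z] A[of z y] B unfolding arcs_H_tree by blast
    qed
  qed (rule pair_graph pair_graph_H_tree)+
qed

section \<open>The converse: invariants and the cases for the cycle vertices\<close>

lemma not_connected_if_invariant:
  assumes "\<And>x y. (x, y) \<in> dist3 R \<Longrightarrow> P x \<longleftrightarrow> P y" "u \<in> V" "v \<in> V" "P u" "\<not> P v"
  shows "\<not> connected (with_proj (distance3_graph G))"
proof
  assume "connected (with_proj (distance3_graph G))"
  then have "(u, v) \<in> (dist3 R)\<^sup>*"
    using assms(2,3) by (simp add: connected_distance3_graph_iff)
  then have "P v"
    by (induction rule: rtrancl_induct) (use assms(1,4) in auto)
  with assms(5) show False ..
qed

text \<open>Here \<open>x2\<close> and \<open>x4\<close> have degree 2, so they are twins; this keeps the folded path from backtracking.\<close>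

lemma fold4_dist3:
  assumes tw: "\<not> pendant R C x2" "\<not> pendant R C x4" and xy: "(x, y) \<in> dist3 R"
  shows "\<exists>a b. (fold4 x, a) \<in> RW \<and> (a, b) \<in> RW \<and> (b, fold4 y) \<in> RW \<and> fold4 x \<noteq> b \<and> a \<noteq> fold4 y"
proof -
  obtain a b where ab: "(x, a) \<in> R" "(a, b) \<in> R" "(b, y) \<in> R" and no: "(x, y) \<notin> R"
    using xy by (auto simp: dist3_def)
  interpret rot: four_cycle_graph G x3 x4 x1 x2
    using four_cycle_graph.four_cycle_rotate[OF four_cycle_rotate] .
  have "\<not> pendant R {x3, x4, x1, x2} x2" using tw(1) by (simp add: insert_commute)
  then have n2: "z = x1 \<or> z = x3" if "(x2, z) \<in> R" for z using rot.nbr_x4 that by blast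
  \<comment> \<open>The twins have the same neighbours. Hence backtracking in the folded path would
    make \<open>x\<close> adjacent to \<open>y\<close>.\<close>
  have tw_nbr: "(p, z) \<in> R" if "p \<in> {x2, x4}" "q \<in> {x2, x4}" "(q, z) \<in> R" for p q z
    using that n2[of z] nbr_x4[OF tw(2), of z] cyc cyc' by auto
  have tw_fold: "p = q \<or> p \<in> {x2, x4} \<and> q \<in> {x2, x4}" if "fold4 p = fold4 q" for p q
    using that by (auto split: if_splits)
  have "x \<noteq> b" "a \<noteq> y" using ab no by auto
  have "fold4 x \<noteq> fold4 b"
    using tw_fold[of x b] tw_nbr[of x b y] ab(3) no \<open>x \<noteq> b\<close> by blast
  moreover have "fold4 a \<noteq> fold4 y"
    using tw_fold[of a y] tw_nbr[of y a x] R_sym[OF ab(1)] R_sym[of y x] no \<open>a \<noteq> y\<close> by blast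
  ultimately show ?thesis
    using fold4_arc[OF tw(2)] ab by blast
qed

text \<open>Otherwise divisibility of the folded level by 3 would be invariant along the 3-distance
  graph.\<close>

lemma branching_if_connected_twins:
  assumes tw: "\<not> pendant R C x2" "\<not> pendant R C x4" and T: "rooted_tree W RW u g l"
    and con: "connected (with_proj (distance3_graph G))"
  shows "\<exists>w s t t'. rooted_tree.branching W u g w s t t' \<and> l w mod 3 \<noteq> 0"
proof (rule ccontr)
  interpret T: rooted_tree W RW u g l by fact
  assume no: "\<not> ?thesis"
  have inv: "l (fold4 x) mod 3 = 0 \<longleftrightarrow> l (fold4 y) mod 3 = 0" if "(x, y) \<in> dist3 R" for x y
    using fold4_dist3[OF tw that] T.level_mod_3_path no by meson
  have W: "x1 \<in> W" "x3 \<in> W" using C_in_V dist by auto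
  obtain z where z: "z \<in> W" "z \<noteq> u" using W dist by (cases "u = x1") auto
  then have "l z \<noteq> 0" using T.level_0 by blast
  \<comment> \<open>An ancestor at level 1, on which the invariant differs from its value at the
    root.\<close>
  then have v: "(g ^^ (l z - 1)) z \<in> W" "l ((g ^^ (l z - 1)) z) = 1"
    using T.funpow_g_in T.funpow_g_level z by auto
  have "\<not> connected (with_proj (distance3_graph G))"
    by (rule not_connected_if_invariant[of "\<lambda>x. l (fold4 x) mod 3 = 0" u "(g ^^ (l z - 1)) z", OF inv]) (use T.root v in auto)
  with con show False by simp
qed

text \<open>Rooting at \<open>x2\<close> yields a branching vertex \<open>w\<close> with neighbours
  \<open>s\<close>, \<open>t\<close> and its parent \<open>r\<close>. Rooting again at
  \<open>w\<close> yields the other end \<open>v\<close> of the spine; the spine uses at most one of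
  these neighbours, so two remain for the tripod at \<open>w\<close>.\<close>

lemma H_tree_if_connected_twins:
  assumes tw: "\<not> pendant R C x2" "\<not> pendant R C x4"
    and con: "connected (with_proj (distance3_graph G))"
  shows "\<exists>n. n mod 3 \<noteq> 0 \<and> has_three_induced G (H_tree n)"
proof -
  have W: "x1 \<in> W" "x2 \<in> W" "x3 \<in> W" using C_in_V dist by auto
  obtain g l where "rooted_tree W RW x2 g l" using rooted_tree_W[OF tw(2) W(2)] by blast
  then interpret T: rooted_tree W RW x2 g l .
  obtain w s t t' where br: "T.branching w s t t'" and lw: "l w mod 3 \<noteq> 0"
    using branching_if_connected_twins[OF tw T.rooted_tree_axioms con] by blast
  then have st: "{w, s, t, t'} \<subseteq> W" "s \<noteq> x2" "t \<noteq> x2" "t' \<noteq> x2" "g s = w" "g t = w" "s \<noteq> t" "g t' = t"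
    by (auto simp: T.branching_def)
  have w: "w \<in> W" "w \<noteq> x2" using st(1) lw T.root(3) by auto
  define r where "r = g w"
  have r: "r \<in> W" "(w, r) \<in> RW" "l w = Suc (l r)" using T.parent[OF w] by (simp_all add: r_def)
  have lst: "l s = Suc (l w)" "l t = Suc (l w)" "l t' = Suc (l t)" "(s, w) \<in> RW" "(t, w) \<in> RW" "(t', t) \<in> RW"
    using T.parent[of s] T.parent[of t] T.parent[of t'] st by auto
  \<comment> \<open>Besides \<open>w\<close>, \<open>r\<close> has its parent or, if
    \<open>r\<close> is the first root \<open>x2\<close>, one of \<open>x1\<close> and
    \<open>x3\<close> as a neighbour.\<close>
  have "\<exists>r'. (r, r') \<in> RW \<and> r' \<noteq> w"
  proof (cases "r = x2")
    case True
    then show ?thesis using cyc cyc' W dist by (cases "w = x1") auto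
  next
    case False
    then have "(r, g r) \<in> RW" "l r = Suc (l (g r))" using T.parent[OF r(1)] by auto
    then show ?thesis using r(3) by (intro exI[of _ "g r"]) auto
  qed
  then obtain r' where r': "(r, r') \<in> RW" "r' \<noteq> w" by blast
  have neq: "r \<noteq> s" "r \<noteq> t" "t' \<noteq> w" using lst r(3) by auto
  obtain g2 l2 where "rooted_tree W RW w g2 l2" using rooted_tree_W[OF tw(2) w(1)] by blast
  then interpret S: rooted_tree W RW w g2 l2 .
  have ch: "g2 z = w \<and> z \<noteq> w" if "(z, w) \<in> RW" for z
    using S.arc[OF that] that no_loops' by auto
  have sg: "g2 s = w" "s \<noteq> w" "g2 t = w" "t \<noteq> w" "g2 r = w" "r \<noteq> w"
    using ch lst(4,5) r(2) R_sym by auto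
  have gg: "g2 t' = t" "g2 r' = r"
    using S.arc[OF lst(6)] S.arc[OF r'(1)] sg neq(3) r'(2) by auto
  obtain v p q q' where v: "S.branching v p q q'" "l2 v mod 3 \<noteq> 0"
    using branching_if_connected_twins[OF tw S.rooted_tree_axioms con] by blast
  then obtain n where n: "l2 v = Suc n" by (cases "l2 v") auto
  have rW: "r' \<in> W" using r' by auto
  \<comment> \<open>\<open>?c\<close> is the spine vertex next to \<open>w\<close>. The legs are
    chosen to avoid it, the longer one through \<open>t\<close> or \<open>r\<close>.\<close>
  let ?c = "(g2 ^^ n) v"
  note H = has_H_tree[OF tw(2) S.rooted_tree_axioms _ _ _ _ _ _ _ v(1) n]
  have "has_three_induced G (H_tree (Suc n))"
  proof (cases "?c = t")
    case True
    then show ?thesis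
      using st(1) r(1) rW sg gg neq st(7) by (intro H[of r' r s]) auto
  next
    case False
    show ?thesis
    proof (cases "?c = r")
      case True
      then show ?thesis
        using st(1) sg gg neq st(7) by (intro H[of t' t s]) auto
    next
      case False
      then show ?thesis
        using st(1) r(1) sg gg neq \<open>?c \<noteq> t\<close> by (intro H[of t' t r]) auto
    qed
  qed
  then show ?thesis using v(2) n by metis
qed

text \<open>The root \<open>x2\<close> has a tripod formed by \<open>x1\<close>, \<open>x3\<close>
  and a leaf at \<open>x1\<close>. As \<open>x1\<close> and \<open>x3\<close> carry only leaves, the
  spine avoids both. Since \<open>x2\<close> may have further neighbours, a folded path could
  backtrack, so paths through \<open>x4\<close> are treated separately.\<close>

lemma H_tree_if_connected_shallow:
  assumes x4: "\<not> pendant R C x4" and x1: "pendant R C x1" "\<not> deep R C x1" and x3: "\<not> deep R C x3"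
    and con: "connected (with_proj (distance3_graph G))"
  shows "\<exists>n. n mod 3 \<noteq> 0 \<and> has_three_induced G (H_tree n)"
proof -
  have W: "x1 \<in> W" "x2 \<in> W" "x3 \<in> W" using C_in_V dist by auto
  obtain g l where "rooted_tree W RW x2 g l" using rooted_tree_W[OF x4 W(2)] by blast
  then interpret T: rooted_tree W RW x2 g l .
  have g13: "g x1 = x2" "g x3 = x2"
    using T.arc[of x1 x2] T.arc[of x3 x2] cyc cyc' W by auto
  then have l13: "l x1 = 1" "l x3 = 1"
    using T.parent[of x1] T.parent[of x3] W dist T.root(3) by auto
  have leaf: "b = x" if "x \<in> {x1, x3}" "(x, a) \<in> R" "a \<notin> C" "(a, b) \<in> R" for x a b
    using that x1(2) x3 by (auto simp: deep_def)
  have off: "l y = 2" if "x \<in> {x1, x3}" "(x, y) \<in> R" "y \<notin> C" for x y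
  proof -
    have "(y, x) \<in> RW" using that W R_sym in_arcsD2 by auto
    then have "y \<noteq> x2 \<and> g y = x" using T.arc[of y x] g13 that by auto
    then show ?thesis using T.parent[of y] l13 that in_arcsD2 \<open>(y, x) \<in> RW\<close> by auto
  qed
  have nbr13: "y = x2 \<or> y = x4 \<or> y \<notin> C" if "x \<in> {x1, x3}" "(x, y) \<in> R" for x y
  proof -
    obtain c :: "'a \<Rightarrow> bool" where c: "\<And>a b. (a, b) \<in> R \<Longrightarrow> c a \<noteq> c b" using bipartite by blast
    then show ?thesis using c[OF cyc(1)] c[OF cyc(2)] c[OF that(2)] that(1) by auto
  qed
  have n4: "a = x1 \<or> a = x3" if "(x4, a) \<in> R" for a using nbr_x4[OF x4 that] .
  \<comment> \<open>\<open>l\<close> is unspecified at \<open>x4\<close>, which is outside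
    \<open>W\<close>. \<open>P\<close> is set to false there, as at level 2: \<open>x4\<close> hangs
    below \<open>x1\<close> and \<open>x3\<close>.\<close>
  define P where "P v \<longleftrightarrow> v \<noteq> x4 \<and> l v mod 3 = 0" for v
  \<comment> \<open>Leaving through \<open>x1\<close> or \<open>x3\<close>, the path cannot enter a
    leaf and go on, so it reaches \<open>x2\<close> and ends at level 1.\<close>
  have via_x4: "\<not> P y" if "(x4, a) \<in> R" "(a, b) \<in> R" "(b, y) \<in> R" "(x4, y) \<notin> R" for a b y
  proof -
    have a: "a \<in> {x1, x3}" "a \<noteq> y" "b \<noteq> x4" using n4 that by auto
    have "b = x2" using nbr13[OF a(1) that(2)] leaf[OF a(1) that(2) _ that(3)] a by blast
    moreover have "y \<noteq> x4" using \<open>b = x2\<close> n4[of b] that(3) R_sym dist by auto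
    ultimately have "(y, x2) \<in> RW" using that(3) R_sym in_arcsD2 W by auto
    moreover have "y \<noteq> x2" using that(3) \<open>b = x2\<close> no_loops' by auto
    ultimately have "l y = 1" using T.arc[of y x2] T.parent[of y] T.root(3) by auto
    then show ?thesis by (simp add: P_def)
  qed
  \<comment> \<open>Here \<open>x\<close> is at level 1 and \<open>y\<close> is an off-cycle
    neighbour of \<open>x1\<close> or \<open>x3\<close>, at level 2.\<close>
  have thru_x4: "\<not> P x \<and> \<not> P y" if "(x, x4) \<in> R" "(x4, b) \<in> R" "(b, y) \<in> R" "(x, y) \<notin> R" for x b y
  proof -
    have x: "x \<in> {x1, x3}" "b \<in> {x1, x3}" using n4 that R_sym by blast+
    have "y \<noteq> x2" "y \<noteq> x4" using x(1) that(1,4) cyc cyc' by auto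
    then have "l y = 2" using off[OF x(2) that(3)] nbr13[OF x(2) that(3)] by blast
    then show ?thesis using x(1) l13 by (auto simp: P_def)
  qed
  have "\<exists>w s t t'. T.branching w s t t' \<and> l w mod 3 \<noteq> 0"
  proof (rule ccontr)
    assume no: "\<not> ?thesis"
    have inv: "P x \<longleftrightarrow> P y" if xy: "(x, y) \<in> dist3 R" for x y
    proof -
      obtain a b where ab: "(x, a) \<in> R" "(a, b) \<in> R" "(b, y) \<in> R" "(x, y) \<notin> R"
        using xy by (auto simp: dist3_def)
      have ba: "(y, b) \<in> R" "(b, a) \<in> R" "(a, x) \<in> R" "(y, x) \<notin> R" using ab R_sym by blast+
      consider "x = x4" | "y = x4" | "a = x4" | "b = x4" | "x \<noteq> x4" "y \<noteq> x4" "a \<noteq> x4" "b \<noteq> x4" by blast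
      then show ?thesis
      proof cases
        case 1
        then show ?thesis using via_x4[of a b y] ab by (auto simp: P_def)
      next
        case 2
        then show ?thesis using via_x4[of b a x] ba by (auto simp: P_def)
      next
        case 3
        then show ?thesis using thru_x4[of x b y] ab by auto
      next
        case 4
        then show ?thesis using thru_x4[of y a x] ba by auto
      next
        case 5
        then have "(x, a) \<in> RW" "(a, b) \<in> RW" "(b, y) \<in> RW" using ab in_arcsD1 in_arcsD2 by auto
        moreover have "x \<noteq> b" "a \<noteq> y" using ab by auto
        ultimately have "l x mod 3 = 0 \<longleftrightarrow> l y mod 3 = 0" using T.level_mod_3_path no by meson
        then show ?thesis using 5 by (simp add: P_def)
      qed
    qed
    have "\<not> connected (with_proj (distance3_graph G))"
      by (rule not_connected_if_invariant[of P x2 x1, OF inv])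
        (use W l13 T.root dist in \<open>auto simp: P_def\<close>)
    with con show False by simp
  qed
  then obtain w s t t' where br: "T.branching w s t t'" and lw: "l w mod 3 \<noteq> 0" by blast
  then obtain n where n: "l w = Suc n" by (cases "l w") auto
  have st: "t' \<in> W" "g t = w" "g t' = t" using br by (auto simp: T.branching_def)
  \<comment> \<open>A descendant of \<open>x1\<close> or \<open>x3\<close> two or more generations
    below would pass through an off-cycle child that is not a leaf.\<close>
  have near: "(g ^^ Suc (Suc k)) y \<noteq> x" if y: "y \<in> W" and x: "x \<in> {x1, x3}" for x y k
  proof
    assume eq: "(g ^^ Suc (Suc k)) y = x"
    define z where "z = (g ^^ k) y"
    have z: "z \<in> W" "g (g z) = x" using eq T.funpow_g_in[OF y] by (simp_all add: z_def)
    have "x \<noteq> x2" using x dist by auto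
    then have "z \<noteq> x2" "g z \<noteq> x2" using z(2) T.root(2) by auto
    moreover have "g z \<noteq> x1" "g z \<noteq> x3" using z(2) g13 \<open>x \<noteq> x2\<close> by auto
    ultimately have "g z \<in> W" "g z \<notin> C" "(z, g z) \<in> RW" "(g z, x) \<in> RW"
      using T.parent[of z] T.parent[of "g z"] z by auto
    then have "z = x" using leaf[OF x, of "g z" z] R_sym by auto
    then show False using z(2) x g13 T.root(2) \<open>x \<noteq> x2\<close> by auto
  qed
  \<comment> \<open>Counting from the grandchild \<open>t'\<close> gives at least two generations,
    so \<open>near\<close> covers \<open>n = 0\<close> as well.\<close>
  have "(g ^^ n) w = (g ^^ Suc (Suc n)) t'" using st by (simp add: funpow_swap1)
  then have c: "(g ^^ n) w \<noteq> x1" "(g ^^ n) w \<noteq> x3" using near[OF st(1), of _ n] by auto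
  obtain a1 where a1: "(x1, a1) \<in> R" "a1 \<notin> C" using x1(1) by (auto simp: pendant_def)
  then have "(a1, x1) \<in> RW" using W R_sym in_arcsD2 by auto
  then have a1': "a1 \<in> W" "g a1 = x1" using T.arc[of a1 x1] g13 a1 by auto
  have "has_three_induced G (H_tree (Suc n))"
    by (rule has_H_tree[OF x4 T.rooted_tree_axioms, of a1 x1 x3 w s t t' n])
      (use W dist g13 a1' br n c in auto)
  then show ?thesis using lw n by metis
qed

text \<open>With \<open>x1\<close> and \<open>x2\<close> pendant, absence of \<open>G2\<close> makes
  \<open>x1\<close> and \<open>x3\<close> shallow if \<open>x3\<close> is pendant too. Otherwise
  absence of \<open>G3\<close> allows only one of \<open>x1\<close>, \<open>x2\<close> to be deep,
  and the shallow one takes the role of \<open>x1\<close>.\<close>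

lemma H_tree_if_connected_pendant:
  assumes x: "\<not> pendant R C x4" "pendant R C x1"
    and con: "connected (with_proj (distance3_graph G))"
    and no: "\<not> has_three_induced G G2" "\<not> has_three_induced G G3"
  shows "\<exists>n. n mod 3 \<noteq> 0 \<and> has_three_induced G (H_tree n)"
proof (cases "pendant R C x2")
  case False
  then show ?thesis using H_tree_if_connected_twins x con by blast
next
  case x2: True
  interpret refl: four_cycle_graph G x3 x2 x1 x4 by (rule four_cycle_reflect)
  interpret rot: four_cycle_graph G x4 x1 x2 x3
    using four_cycle_graph.four_cycle_rotate[OF four_cycle_graph.four_cycle_rotate[OF four_cycle_rotate]] .
  interpret swap: four_cycle_graph G x2 x1 x4 x3 by (rule rot.four_cycle_reflect)
  have C_eq: "{x3, x2, x1, x4} = C" "{x4, x1, x2, x3} = C" "{x2, x1, x4, x3} = C" by auto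
  have pd: "pendant R C x" if "deep R C x" for x using that by (auto simp: pendant_def deep_def)
  show ?thesis
  proof (cases "pendant R C x3")
    case True
    then have "\<not> deep R C x3" "\<not> deep R C x1"
      using has_G2[OF x(2) x2] refl.has_G2 x2 no(1) unfolding C_eq by blast+
    then show ?thesis using H_tree_if_connected_shallow[OF x _ _ con] by blast
  next
    case False
    then have x3: "\<not> deep R C x3" using pd by blast
    show ?thesis
    proof (cases "deep R C x1")
      case True
      then have "\<not> deep R C x2" using rot.has_G3 no(2) unfolding C_eq by blast
      moreover have "\<not> deep R C x4" using pd x(1) by blast
      ultimately show ?thesis
        \<comment> \<open>In the labelling \<open>x2, x1, x4, x3\<close> the root is
          \<open>x1\<close> and the deleted vertex is \<open>x3\<close>.\<close>
        using swap.H_tree_if_connected_shallow[OF _ _ _ _ con] x2 False unfolding C_eq by blast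
    next
      case False
      then show ?thesis using H_tree_if_connected_shallow[OF x False x3 con] by blast
    qed
  qed
qed

text \<open>A reflection covers a pendant \<open>x3\<close>; if neither \<open>x1\<close> nor
  \<open>x3\<close> is pendant, a rotation makes them the twins.\<close>

lemma H_tree_if_connected:
  assumes x4: "\<not> pendant R C x4"
    and con: "connected (with_proj (distance3_graph G))"
    and no: "\<not> has_three_induced G G2" "\<not> has_three_induced G G3"
  shows "\<exists>n. n mod 3 \<noteq> 0 \<and> has_three_induced G (H_tree n)"
proof -
  interpret refl: four_cycle_graph G x3 x2 x1 x4 by (rule four_cycle_reflect)
  interpret rot: four_cycle_graph G x2 x3 x4 x1 by (rule four_cycle_rotate)
  have C_eq: "{x3, x2, x1, x4} = C" "{x2, x3, x4, x1} = C" by auto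
  consider "pendant R C x1" | "pendant R C x3" | "\<not> pendant R C x1" "\<not> pendant R C x3" by blast
  then show ?thesis
  proof cases
    case 1
    then show ?thesis using H_tree_if_connected_pendant x4 con no by blast
  next
    case 2
    then show ?thesis using refl.H_tree_if_connected_pendant x4 con no unfolding C_eq by blast
  next
    case 3
    then show ?thesis using rot.H_tree_if_connected_twins con unfolding C_eq by blast
  qed
qed

theorem connected_distance3_graph_four_cycle:
  "connected (with_proj (distance3_graph G)) \<longleftrightarrow>
    (\<exists>n. n mod 3 \<noteq> 0 \<and> has_three_induced G (H_tree n)) \<or>
    has_three_induced G G1 \<or> has_three_induced G G2 \<or> has_three_induced G G3"
proof
  assume con: "connected (with_proj (distance3_graph G))"
  \<comment> \<open>Without \<open>G1\<close> some cycle vertex has no off-cycle neighbour; a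
    rotation puts it in position \<open>x4\<close>.\<close>
  interpret r1: four_cycle_graph G x2 x3 x4 x1 by (rule four_cycle_rotate)
  interpret r2: four_cycle_graph G x3 x4 x1 x2 by (rule r1.four_cycle_rotate)
  interpret r3: four_cycle_graph G x4 x1 x2 x3 by (rule r2.four_cycle_rotate)
  have C_eq: "{x2, x3, x4, x1} = C" "{x3, x4, x1, x2} = C" "{x4, x1, x2, x3} = C" by auto
  show "(\<exists>n. n mod 3 \<noteq> 0 \<and> has_three_induced G (H_tree n)) \<or>
    has_three_induced G G1 \<or> has_three_induced G G2 \<or> has_three_induced G G3"
    using has_G1 con H_tree_if_connected r1.H_tree_if_connected r2.H_tree_if_connected
      r3.H_tree_if_connected
    unfolding C_eq by blast
next
  assume "(\<exists>n. n mod 3 \<noteq> 0 \<and> has_three_induced G (H_tree n)) \<or>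
    has_three_induced G G1 \<or> has_three_induced G G2 \<or> has_three_induced G G3"
  then show "connected (with_proj (distance3_graph G))"
    using connected_if_H_tree connected_if_G1 connected_if_G2 connected_if_G3 by blast
qed

end

section \<open>From unicyclic graphs to the locale, and from residues modulo 3 to the two
  families\<close>

lemma four_cycle_graph_if_unicyclic:
  assumes "unicyclic G" "distinct [x1, x2, x3, x4]" "cycle_subgraph (cycle_graph [x1, x2, x3, x4]) G"
  shows "four_cycle_graph G x1 x2 x3 x4"
proof -
  interpret pair_graph G using assms(1) by (simp add: unicyclic_def)
  have sub: "parcs G \<subseteq> pverts G \<times> pverts G" using in_arcsD1 in_arcsD2 by auto
  show ?thesis
  proof unfold_locales
    show "(u, v) \<in> (parcs G)\<^sup>*" if "u \<in> pverts G" "v \<in> pverts G" for u v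
    proof -
      have "sym (parcs G)" using arcs_symmetric by (auto simp: sym_def)
      then show ?thesis
        using assms(1) that connected_pair_iff[OF sub] by (auto simp: unicyclic_def)
    qed
    have "parcs (cycle_graph [x1, x2, x3, x4]) \<subseteq> parcs G"
      using assms(3) by (auto simp: cycle_subgraph_def subgraph_def)
    then show "(x1, x2) \<in> parcs G" "(x2, x3) \<in> parcs G" "(x3, x4) \<in> parcs G" "(x4, x1) \<in> parcs G"
      by (auto simp: parcs_cycle_graph_4)
    fix xs assume "distinct xs" "3 \<le> length xs" "set (zip xs (rotate1 xs)) \<subseteq> parcs G"
    then have "cycle_subgraph (cycle_graph xs) G" by (intro cycle_subgraphI pair_graph)
    then show "parcs (cycle_graph xs) = parcs (cycle_graph [x1, x2, x3, x4])"
      using assms(1,3) by (metis unicyclic_def)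
  qed (rule assms(2))
qed

theorem theorem2p15:
  fixes G H :: "'a pair_pre_digraph" and x1 x2 x3 x4 :: 'a
  assumes "unicyclic G"
    and "distinct [x1, x2, x3, x4]"
    and "H = cycle_graph [x1, x2, x3, x4]"
    and "cycle_subgraph H G"
  shows "Digraph_Component.connected (with_proj (distance3_graph G)) \<longleftrightarrow>
    (\<exists>k. has_three_induced G (H_tree (3 * k + 1)) \<or> has_three_induced G (H_tree (3 * k + 2)))
    \<or> has_three_induced G G1 \<or> has_three_induced G G2 \<or> has_three_induced G G3"
proof -
  interpret four_cycle_graph G x1 x2 x3 x4
    using assms(4) unfolding assms(3) by (rule four_cycle_graph_if_unicyclic[OF assms(1,2)])
  have "(\<exists>n. n mod 3 \<noteq> 0 \<and> P n) \<longleftrightarrow> (\<exists>k. P (3 * k + 1) \<or> P (3 * k + 2))" for P :: "nat \<Rightarrow> bool"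
  proof
    assume "\<exists>n. n mod 3 \<noteq> 0 \<and> P n"
    then obtain n where n: "n mod 3 \<noteq> 0" "P n" by blast
    moreover have "n = 3 * (n div 3) + 1 \<or> n = 3 * (n div 3) + 2" using n(1) by presburger
    ultimately show "\<exists>k. P (3 * k + 1) \<or> P (3 * k + 2)" by metis
  next
    assume "\<exists>k. P (3 * k + 1) \<or> P (3 * k + 2)"
    moreover have "(3 * k + 1) mod 3 \<noteq> 0" "(3 * k + 2) mod 3 \<noteq> 0" for k :: nat by presburger+
    ultimately show "\<exists>n. n mod 3 \<noteq> 0 \<and> P n" by blast
  qed
  from connected_distance3_graph_four_cycle[unfolded this] show ?thesis .
qed

end
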